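(* Let $q = p^s$ be a power of a prime $p$, let $m > 1$ be such that $sm$ is even, and let $Q = (q^m-1)/(q-1)$. Let $N \mid q^m-1$ be such that $n := \gcd(Q, N) > 1$ is not a power of $2$. Further assume there exists a positive integer $j$ such that $p^j \equiv -1 \pmod{\ell}$ for every prime divisor $\ell \geq 3$ of $n$, and that $j$ is the least such. Define $\gamma = sm/2j$, i.e. $\gamma = sm/(2j)$. Let $K_Q$ be the largest divisor of $N$ that is coprime to $Q$. Then the number of $N$-free elements $\xi \in \mathbb{F}_{q^m}$ with $\operatorname{Tr}_{\mathbb{F}_{q^m}/\mathbb{F}_q}(\xi) = 0$ is given by $$Z_{q,m, N}(0) = \frac{(q-1)\phi(K_Q)}{qK_Q} \left( \frac{Q}{n} \phi(n) + \Delta_0(n) \right),$$ where the value of $\Delta_0(n)$ is as follows. (a) If $\gamma$ and $p$ are odd, $n$ is even and $(p^j+1)/2$ is odd, then $$\Delta_0(n) = - \eta_0^{(2,q^m)} - \left( 1 + q^{m/2} \right)\left( \frac{1}{2} + \frac{\phi(n)}{n} \right).$$ (b) In all other cases, $$\Delta_0(n) = -\epsilon_2 \cdot \left(\frac{(-1)^{\gamma}q^{m/2} + 1}{2} + \eta_0^{(2,q^m)}\right) + \frac{(-1)^{\gamma} q^{m/2} -1}{n}\, \phi(n),$$ where $\epsilon_2 = 1$ if $n$ is even and $\epsilon_2 = 0$ otherwise.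
   Context: $\phi$ is Euler's function, $\mu$ the Möbius function, and divisors are positive. Let $\alpha$ be a primitive element of $\mathbb{F}_{q^m}$. For a positive divisor $N$ of $q^m-1$, a non-zero element $\xi \in \mathbb{F}_{q^m}^*$ is called $N$-free if, for any $d \mid N$, $\xi = \gamma^d$ with $\gamma \in \mathbb{F}_{q^m}$ implies $d=1$; equivalently $\xi = \alpha^k$ for some integer $k$ coprime to $N$. For $c \in \mathbb{F}_q$, $Z_{q,m,N}(c)$ denotes the number of $N$-free elements $\xi \in \mathbb{F}_{q^m}^*$ with $\operatorname{Tr}_{\mathbb{F}_{q^m}/\mathbb{F}_q}(\xi) = c$. Let $\chi_{q^m}(z) = e^{2\pi\sqrt{-1}\operatorname{Tr}_{\mathbb{F}_{q^m}/\mathbb{F}_p}(z)/p}$ be the canonical additive character of $\mathbb{F}_{q^m}$. For $d \mid q^m-1$ and $k \in \mathbb{Z}$, the $k$-th Gaussian period of type $(d,q^m)$ is $\eta_k^{(d,q^m)} = \sum_{x \in \alpha^k\langle \alpha^d\rangle} \chi_{q^m}(x)$, and for $n \mid q^m-1$, $\Delta_k(n) = \sum_{d \mid n} \mu(d)\, \eta_k^{(d,q^m)}$. The quadratic period (used only for $p$ odd; if $p=2$ then $n$ is odd and the term multiplied by $\epsilon_2=0$ is read as $0$) has the value $$\eta_0^{(2,q^m)} = \begin{cases} \frac{-1 + (-1)^{sm-1}q^{m/2}}{2} & \text{if } p \equiv 1 \pmod 4;\\ \frac{-1 + (-1)^{sm-1} (\sqrt{-1})^{sm} q^{m/2}}{2}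 & \text{if } p \equiv 3 \pmod 4.\end{cases}$$ *)

theory Defs
  imports
    "HOL-Analysis.Analysis"
    "HOL-Number_Theory.Number_Theory"
    "HOL-Computational_Algebra.Computational_Algebra"
begin

text \<open>
  The field with \<open>q ^ m\<close> elements is a type \<open>'a :: {field, finite}\<close> with \<open>CARD('a) = q ^ m\<close>.
  Its subfield with \<open>q\<close> elements is \<open>{x. x ^ q = x}\<close>; the trace takes its values there.
\<close>

text \<open>The trace of the extension of degree \<open>m\<close> over the subfield with \<open>q\<close> elements:
  the sum of the conjugates \<open>x, x ^ q, \<dots>, x ^ (q ^ (m - 1))\<close>.\<close>
definition field_trace :: "nat \<Rightarrow> nat \<Rightarrow> 'a::{field, finite} \<Rightarrow> 'a" where
  "field_trace q m x = (\<Sum>i<m. x ^ (q ^ i))"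

definition primitive_element :: "'a::{field, finite} \<Rightarrow> bool" where
  "primitive_element \<alpha> \<longleftrightarrow> \<alpha> \<noteq> 0 \<and> (\<forall>x. x \<noteq> 0 \<longrightarrow> (\<exists>i::nat. x = \<alpha> ^ i))"

definition N_free :: "nat \<Rightarrow> 'a::{field, finite} \<Rightarrow> bool" where
  "N_free N \<xi> \<longleftrightarrow> \<xi> \<noteq> 0 \<and> (\<forall>d. d dvd N \<longrightarrow> (\<exists>\<gamma>. \<xi> = \<gamma> ^ d) \<longrightarrow> d = 1)"

definition Z_count :: "nat \<Rightarrow> nat \<Rightarrow> nat \<Rightarrow> 'a::{field, finite} \<Rightarrow> nat" where
  "Z_count q m N c = card {\<xi>. N_free N \<xi> \<and> field_trace q m \<xi> = c}"

definition moebius_mu :: "nat \<Rightarrow> int" where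
  "moebius_mu n = (if squarefree n then (-1) ^ card (prime_factors n) else 0)"

text \<open>For a field of characteristic \<open>p\<close>, the representative in \<open>{0..<p}\<close> of an element of
  the prime field.\<close>
definition prime_field_rep :: "nat \<Rightarrow> 'a::{field, finite} \<Rightarrow> nat" where
  "prime_field_rep p z = (THE k. k < p \<and> of_nat k = z)"

text \<open>The canonical additive character of the field with \<open>p ^ e\<close> elements, \<open>p\<close> prime.\<close>
definition canonical_char :: "nat \<Rightarrow> nat \<Rightarrow> 'a::{field, finite} \<Rightarrow> complex" where
  "canonical_char p e z =
     exp (2 * of_real pi * \<i> * of_nat (prime_field_rep p (field_trace p e z)) / of_nat p)"

text \<open>The \<open>k\<close>-th Gaussian period of type \<open>(d, p ^ e)\<close> with respect to the primitive
  element \<open>\<alpha>\<close>. The sum is over the coset as a set, so each element counts once.\<close>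
definition gaussian_period ::
    "nat \<Rightarrow> nat \<Rightarrow> 'a::{field, finite} \<Rightarrow> nat \<Rightarrow> int \<Rightarrow> complex" where
  "gaussian_period p e \<alpha> d k =
     (\<Sum>x \<in> range (\<lambda>i::nat. (\<alpha> powi k) * (\<alpha> ^ d) ^ i). canonical_char p e x)"

definition Delta ::
    "nat \<Rightarrow> nat \<Rightarrow> 'a::{field, finite} \<Rightarrow> int \<Rightarrow> nat \<Rightarrow> complex" where
  "Delta p e \<alpha> k n =
     (\<Sum>d \<in> {d. d dvd n}. of_int (moebius_mu d) * gaussian_period p e \<alpha> d k)"

text \<open>The largest divisor of \<open>N\<close> coprime to \<open>Q\<close>, for \<open>N > 0\<close>.\<close>
definition coprime_part :: "nat \<Rightarrow> nat \<Rightarrow> nat" where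
  "coprime_part N Q = Max {k. k dvd N \<and> coprime k Q}"

text \<open>\<open>j\<close> is the least positive integer with \<open>p ^ j \<equiv> -1\<close> modulo every odd prime divisor
  of \<open>n\<close> simultaneously.\<close>
definition semiprimitive_exponent :: "nat \<Rightarrow> nat \<Rightarrow> nat \<Rightarrow> bool" where
  "semiprimitive_exponent p n j \<longleftrightarrow>
     is_arg_min id
       (\<lambda>i. i > 0 \<and> (\<forall>l. prime l \<and> l \<ge> 3 \<and> l dvd n \<longrightarrow> [int p ^ i = -1] (mod int l))) j"

end

theory Submission
  imports Defs
begin

text \<open>
  Write \<open>e = s * m\<close>, \<open>w = q ^ m - 1\<close>, \<open>P = p ^ j\<close> and \<open>M = P + 1\<close>, and let \<open>\<psi>\<close> be the canonical
  additive character.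

  The first claim is a reduction of the count to Gaussian periods. Moebius inversion over the
  exponents of \<open>\<alpha>\<close> writes the count as a signed sum, over the squarefree divisors \<open>d\<close> of \<open>N\<close>, of the
  number of nonzero \<open>d\<close>-th powers of trace \<open>0\<close> (\<open>count_N_free\<close>). The kernel of the trace is stable
  under the nonzero elements of the subfield with \<open>q\<close> elements, which are the \<open>Q\<close>-th powers. Hence a
  factor of \<open>d\<close> that is coprime to \<open>Q\<close> only scales the number (\<open>trace_zero_count_coprime\<close>), and these
  factors, the divisors of \<open>K\<close>, contribute \<open>totient K / K\<close>. For the other factors, the divisors of
  \<open>n\<close>, orthogonality of \<open>\<psi>\<close> over the subfield expresses the number through the period
  (\<open>trace_zero_count_period\<close>).

  The second claim rests on the evaluation of the periods of type \<open>d\<close> for divisors \<open>d\<close> of \<open>M\<close>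
  (\<open>period_semiprimitive\<close>), which apply because every squarefree divisor of \<open>n\<close> divides \<open>M\<close>. Up to
  a factor \<open>d\<close>, they are averages over the \<open>d\<close>-th powers \<open>a\<close> of the sum of \<open>\<psi> (a * x ^ M)\<close> over all
  \<open>x \<noteq> 0\<close>. The exponent \<open>M = P + 1\<close> makes the trace of \<open>a * x ^ M\<close> a Hermitian form: completing the
  square shows that the square of the sum over all \<open>x\<close> is \<open>p ^ e\<close> times the size of the kernel of the
  form, which is \<open>1\<close> or \<open>P\<^sup>2\<close> (\<open>hermitian_sum_square\<close>, \<open>card_kernel\<close>). Its sign is fixed by a
  congruence (\<open>hermitian_sum_integral\<close>). The sum does not change when \<open>a\<close> is multiplied by nonzero
  elements of the prime field, so it can be expressed by the number of \<open>x\<close> with \<open>a * x ^ M\<close> of trace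
  \<open>0\<close>; these \<open>x\<close> are permuted by a group of roots of unity of order \<open>M * (p - 1)\<close>, and it follows that
  the sum is an integer congruent to \<open>1\<close> modulo \<open>M\<close>. The kernel is nontrivial for \<open>a\<close> in a single
  coset of the \<open>M\<close>-th powers, and the value of the period depends only on whether this coset consists
  of \<open>d\<close>-th powers.

  With \<open>A = (- 1) ^ \<gamma> * r\<close>, the period of type \<open>d\<close> is therefore \<open>(A - 1) / d - A\<close> or \<open>(A - 1) / d\<close>.
  The terms \<open>- A\<close> occur for all squarefree divisors of \<open>n\<close>, or in the first case of the statement for the
  odd ones. Their
  Moebius sum is \<open>0\<close> either way, because \<open>n\<close> is not a power of \<open>2\<close>, so \<open>Delta\<close> is
  \<open>(A - 1) * totient n / n\<close> in every case. Both stated formulas reduce to this value once the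
  quadratic period, the case \<open>d = 2\<close>, is inserted.
\<close>

section \<open>Sums over divisors weighted by the Moebius function\<close>

lemma moebius_mu_mult_coprime:
  assumes "coprime a b"
  shows "moebius_mu (a * b) = moebius_mu a * moebius_mu b"
proof (cases "squarefree (a * b)")
  case True
  then have sq: "squarefree a" "squarefree b"
    by (auto dest: squarefree_multD)
  have nz: "a \<noteq> 0" "b \<noteq> 0"
    using sq not_squarefree_0 by metis+
  have "prime_factors (a * b) = prime_factors a \<union> prime_factors b"
    using nz by (simp add: prime_factors_product)
  moreover have "prime_factors a \<inter> prime_factors b = {}"
  proof (intro equals0I, elim IntE)
    fix l assume "l \<in> prime_factors a" "l \<in> prime_factors b"
    then have "prime l" "l dvd a" "l dvd b"
      by (auto dest: in_prime_factors_imp_prime)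
    then show False
      using coprime_common_divisor_nat[OF assms] not_prime_1 by metis
  qed
  ultimately show ?thesis
    using True sq by (simp add: moebius_mu_def card_Un_disjoint power_add)
next
  case False
  then have "\<not> squarefree a \<or> \<not> squarefree b"
    using squarefree_mult_coprime[OF assms] by blast
  then show ?thesis
    using False by (auto simp: moebius_mu_def)
qed

lemma squarefree_eq_prod_prime_factors:
  assumes "squarefree (d::nat)"
  shows "\<Prod>(prime_factors d) = d"
proof -
  have nz: "d \<noteq> 0" using assms by (cases "d = 0") auto
  have "d = (\<Prod>l \<in> prime_factors d. l ^ multiplicity l d)"
    by (rule prime_factorization_nat) (use nz in simp)
  also have "\<dots> = (\<Prod>l \<in> prime_factors d. l)"
    using assms nz by (intro prod.cong) (auto simp: squarefree_factorial_semiring')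
  finally show ?thesis by simp
qed

lemma squarefree_dvdI:
  assumes "squarefree (d::nat)" and "\<And>l. prime l \<Longrightarrow> l dvd d \<Longrightarrow> l dvd k"
  shows "d dvd k"
proof (cases "k = 0")
  case False
  have nz: "d \<noteq> 0" using assms(1) by (cases "d = 0") auto
  show ?thesis
  proof (rule multiplicity_le_imp_dvd[OF nz])
    fix l :: nat assume l: "prime l"
    have "multiplicity l d \<le> 1"
      using assms(1) nz l by (simp add: squarefree_factorial_semiring'')
    moreover have "multiplicity l d = 0" if "\<not> l dvd d"
      using that by (rule not_dvd_imp_multiplicity_0)
    moreover have "multiplicity l k \<ge> 1" if "l dvd d"
      using assms(2)[OF l that] l False by (intro multiplicity_geI) auto
    ultimately show "multiplicity l d \<le> multiplicity l k"
      by (cases "l dvd d") auto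
  qed
qed simp

lemma prod_primes_squarefree:
  assumes "finite X" and "\<And>l. l \<in> X \<Longrightarrow> prime (l::nat)"
  shows "squarefree (\<Prod>X)" and "prime_factors (\<Prod>X) = X"
proof -
  show "squarefree (\<Prod>X)"
    using assms(2) by (intro squarefree_prod_coprime) (auto simp: primes_coprime squarefree_prime)
  have "prime_factors (\<Prod>X) = (\<Union>l\<in>X. prime_factors l)"
    using assms by (subst prime_factors_prod) (force dest: prime_gt_0_nat)+
  also have "\<dots> = X"
    using assms(2) by (auto simp: prime_factorization_prime)
  finally show "prime_factors (\<Prod>X) = X" .
qed

text \<open>
  The Euler product of a finite Moebius sum: expanding the product on the right gives one term
  for every set of prime factors of \<open>n\<close>, and these sets are the squarefree divisors of \<open>n\<close>.
\<close>
lemma sum_moebius_eq_prod: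
  fixes h :: "nat \<Rightarrow> 'b::comm_ring_1"
  assumes "n > 0"
  shows "(\<Sum>d | d dvd n. of_int (moebius_mu d) * (\<Prod>l\<in>prime_factors d. h l)) =
         (\<Prod>l\<in>prime_factors n. 1 - h l)"
proof -
  let ?F = "\<lambda>d. of_int (moebius_mu d) * (\<Prod>l\<in>prime_factors d. h l)"
  have "(\<Prod>l\<in>prime_factors n. 1 - h l) = (\<Prod>l\<in>prime_factors n. - h l + 1)"
    by simp
  also have "\<dots> = (\<Sum>X\<in>Pow (prime_factors n). (\<Prod>l\<in>X. - h l))"
    by (subst prod_add) auto
  also have "\<dots> = (\<Sum>X\<in>Pow (prime_factors n). ?F (\<Prod>X))"
  proof (intro sum.cong refl)
    fix X assume X: "X \<in> Pow (prime_factors n)"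
    then have fin: "finite X" and pr: "\<And>l. l \<in> X \<Longrightarrow> prime l"
      by (auto intro: finite_subset)
    show "(\<Prod>l\<in>X. - h l) = ?F (\<Prod>X)"
      using prod_primes_squarefree[OF fin pr]
      by (simp add: moebius_mu_def prod_uminus)
  qed
  also have "\<dots> = (\<Sum>d | d dvd n \<and> squarefree d. ?F d)"
  proof (rule sum.reindex_bij_witness[of _ prime_factors "\<lambda>X. \<Prod>X"])
    fix X assume X: "X \<in> Pow (prime_factors n)"
    then have fin: "finite X" and pr: "\<And>l. l \<in> X \<Longrightarrow> prime l"
      by (auto intro: finite_subset)
    note * = prod_primes_squarefree[OF fin pr]
    show "prime_factors (\<Prod>X) = X" by (rule *)
    have "\<Prod>X dvd n"
    proof (rule squarefree_dvdI[OF *(1)])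
      fix l :: nat assume "prime l" "l dvd \<Prod>X"
      then have "l \<in> prime_factors (\<Prod>X)"
        using *(1) not_squarefree_0 by (metis prime_factorsI)
      then show "l dvd n"
        using X *(2) by auto
    qed
    then show "\<Prod>X \<in> {d. d dvd n \<and> squarefree d}"
      using * by simp
  next
    fix d assume d: "d \<in> {d. d dvd n \<and> squarefree d}"
    then show "\<Prod>(prime_factors d) = d"
      by (simp add: squarefree_eq_prod_prime_factors)
    show "prime_factors d \<in> Pow (prime_factors n)"
      using d assms by (auto simp: prime_factors_dvd)
  qed auto
  also have "\<dots> = (\<Sum>d | d dvd n. ?F d)"
    using assms by (intro sum.mono_neutral_left) (auto simp: moebius_mu_def)
  finally show ?thesis by simp
qed

lemma sum_moebius:
  assumes "n > 0"
  shows "(\<Sum>d | d dvd n. moebius_mu d) = (if n = 1 then 1 else 0)"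
proof -
  have "(\<Sum>d | d dvd n. moebius_mu d) = (\<Prod>l\<in>prime_factors n. 0)"
    using sum_moebius_eq_prod[OF assms, of "\<lambda>_. 1::int"] by simp
  moreover have "prime_factors n \<noteq> {}" if "n \<noteq> 1"
    using prime_factor_nat[OF that] assms by (auto simp: prime_factors_dvd)
  ultimately show ?thesis
    by (cases "n = 1") (auto simp: card_gt_0_iff)
qed

lemma sum_moebius_div:
  assumes "n > 0"
  shows "(\<Sum>d | d dvd n. of_int (moebius_mu d) / of_nat d) =
         (of_nat (totient n) / of_nat n :: 'b::real_field)"
proof -
  have "(\<Sum>d | d dvd n. of_int (moebius_mu d) / of_nat d) =
        (\<Sum>d | d dvd n. of_int (moebius_mu d) * (\<Prod>l\<in>prime_factors d. 1 / real l))"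
  proof (intro sum.cong refl)
    fix d
    show "of_int (moebius_mu d) / of_nat d =
          of_int (moebius_mu d) * (\<Prod>l\<in>prime_factors d. 1 / real l)"
    proof (cases "squarefree d")
      case True
      have "(\<Prod>l\<in>prime_factors d. 1 / real l) = 1 / real (\<Prod>(prime_factors d))"
        by (simp add: prod_dividef)
      then show ?thesis
        using squarefree_eq_prod_prime_factors[OF True] by simp
    qed (simp add: moebius_mu_def)
  qed
  also have "\<dots> = (\<Prod>l\<in>prime_factors n. 1 - 1 / real l)"
    by (rule sum_moebius_eq_prod[OF assms])
  also have "\<dots> = real (totient n) / real n"
    using assms by (simp add: totient_formula2)
  finally have "of_real (\<Sum>d | d dvd n. of_int (moebius_mu d) / of_nat d) =
                (of_real (real (totient n) / real n) :: 'b)"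
    by simp
  then show ?thesis by simp
qed

lemma exists_odd_prime_divisor:
  assumes "n > 0" "\<nexists>k. (n::nat) = 2 ^ k"
  shows "\<exists>l. prime l \<and> l \<ge> 3 \<and> l dvd n"
proof (rule ccontr)
  assume *: "\<not> ?thesis"
  have "l = 2" if "l \<in> prime_factors n" for l
  proof -
    have "prime l" "l dvd n" using that by (auto dest: in_prime_factors_imp_prime)
    then have "l < 3" "l > 1" using * prime_gt_1_nat by (auto simp: not_le)
    then show ?thesis by linarith
  qed
  then have "n = (\<Prod>l \<in> prime_factors n. 2 ^ multiplicity l n)"
    using prime_factorization_nat[OF assms(1)] by (metis (no_types, lifting) prod.cong)
  also have "\<dots> = 2 ^ (\<Sum>l \<in> prime_factors n. multiplicity l n)"
    by (simp add: power_sum)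
  finally show False using assms(2) by blast
qed

text \<open>An odd prime factor of \<open>n\<close> makes one factor of the Euler product over the odd primes vanish.\<close>
lemma sum_moebius_odd:
  assumes "n > 0" and "\<nexists>k. n = 2 ^ k"
  shows "(\<Sum>d | d dvd n \<and> odd d. moebius_mu d) = 0"
proof -
  obtain l where "prime l" "l \<ge> 3" "l dvd n"
    using exists_odd_prime_divisor[OF assms] by blast
  then have l: "l \<in> prime_factors n" "l \<noteq> 2"
    using assms(1) by (auto simp: prime_factors_dvd)
  have h: "(\<Prod>l\<in>prime_factors d. if l = 2 then 0 else 1::int) = (if odd d then 1 else 0)"
    if "d dvd n" for d
  proof -
    have "d > 0" using that assms(1) by (auto intro: Nat.gr0I)
    then have "2 \<in> prime_factors d \<longleftrightarrow> even d"
      by (auto simp: prime_factors_dvd)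
    then show ?thesis by auto
  qed
  have "(\<Sum>d | d dvd n \<and> odd d. moebius_mu d) =
        (\<Sum>d | d dvd n. moebius_mu d * (if odd d then 1 else 0))"
    using assms(1) by (intro sum.mono_neutral_cong_left) auto
  also have "\<dots> = (\<Sum>d | d dvd n. of_int (moebius_mu d) * (\<Prod>l\<in>prime_factors d. if l = 2 then 0 else 1))"
    by (intro sum.cong refl) (use h in auto)
  also have "\<dots> = (\<Prod>l\<in>prime_factors n. 1 - (if l = 2 then 0 else 1))"
    by (rule sum_moebius_eq_prod[OF assms(1)])
  also have "\<dots> = 0"
    using l by auto
  finally show ?thesis .
qed

lemma sum_divisors_mult_coprime:
  assumes "coprime a (b::nat)" and "a > 0" "b > 0"
  shows "(\<Sum>d | d dvd a * b. f d) = (\<Sum>x | x dvd a. \<Sum>y | y dvd b. f (x * y))"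
proof -
  have *: "gcd (x * y) a = x \<and> gcd (x * y) b = y" if "x dvd a" "y dvd b" for x y
  proof -
    have "coprime y a" "coprime x b"
      using that assms(1) coprime_divisors[of x a b b] coprime_divisors[of a a y b]
      by (auto simp: coprime_commute)
    then have "gcd (x * y) a = gcd x a" "gcd (x * y) b = gcd y b"
      using gcd_mult_left_right_cancel[of a y x] gcd_mult_left_left_cancel[of b x y]
      by (simp_all add: coprime_commute)
    then show ?thesis
      using that by (simp add: gcd_proj1_if_dvd)
  qed
  have "(\<Sum>x | x dvd a. \<Sum>y | y dvd b. f (x * y)) =
        (\<Sum>(x, y) \<in> {x. x dvd a} \<times> {y. y dvd b}. f (x * y))"
    by (rule sum.cartesian_product)
  also have "\<dots> = (\<Sum>d | d dvd a * b. f d)"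
  proof (rule sum.reindex_bij_witness[of _ "\<lambda>d. (gcd d a, gcd d b)" "\<lambda>(x, y). x * y"])
    fix d assume d: "d \<in> {d. d dvd a * b}"
    then obtain x y where "d = x * y" "x dvd a" "y dvd b"
      using division_decomp by blast
    then show "(case (gcd d a, gcd d b) of (x, y) \<Rightarrow> x * y) = d"
      using * by simp
  qed (use * in \<open>auto intro: mult_dvd_mono\<close>)
  finally show ?thesis by simp
qed

section \<open>Powers in the cyclic group of a finite field\<close>

text \<open>
  The order \<open>w\<close> of the multiplicative group is a parameter, so that statements can mention it as a
  plain number. In terms of exponents of \<open>\<alpha>\<close>, the nonzero \<open>d\<close>-th powers are, for \<open>d\<close>
  dividing \<open>w\<close>, the multiples of \<open>d\<close>; they are the sets over which the Gaussian periods are formed.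
\<close>
locale cyclic_field =
  fixes \<alpha> :: "'a::{field, finite}" and w :: nat
  assumes primitive: "primitive_element \<alpha>" and w_def: "w = CARD('a) - 1"
begin

lemma alpha_nonzero [simp]: "\<alpha> \<noteq> 0"
  using primitive by (simp add: primitive_element_def)

lemma exponent_exists: "x \<noteq> 0 \<Longrightarrow> \<exists>i::nat. x = \<alpha> ^ i"
  using primitive by (simp add: primitive_element_def)

lemma card_nonzero: "card (- {0} :: 'a set) = w"
  by (simp add: Compl_eq_Diff_UNIV card_Diff_singleton w_def)

text \<open>
  The powers of \<open>\<alpha>\<close> run through the nonzero elements with the least positive period \<open>r\<close>, and
  counting them gives \<open>r = w\<close>.
\<close>
lemma alpha_power_order:
  shows w_pos: "w > 0" and alpha_power_eq_1_iff: "\<alpha> ^ k = 1 \<longleftrightarrow> w dvd k"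
    and bij_alpha_power: "bij_betw (\<lambda>i. \<alpha> ^ i) {..<w} (- {0})"
proof -
  have "\<not> inj (\<lambda>i::nat. \<alpha> ^ i)"
    using finite_imageD[of "\<lambda>i::nat. \<alpha> ^ i" UNIV] by auto
  then obtain i j :: nat where "i < j" "\<alpha> ^ i = \<alpha> ^ j"
    by (metis injI linorder_neqE_nat)
  then have "\<alpha> ^ (j - i) = 1" "j - i > 0"
    by (auto simp: power_diff)
  then have ex: "\<exists>r. r > 0 \<and> \<alpha> ^ r = 1" by blast
  define r where "r = (LEAST r. r > 0 \<and> \<alpha> ^ r = 1)"
  have r: "r > 0" "\<alpha> ^ r = 1"
    using LeastI_ex[OF ex] by (auto simp: r_def)
  have least: "k = 0" if "k < r" "\<alpha> ^ k = 1" for k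
    using not_less_Least[of k "\<lambda>r. r > 0 \<and> \<alpha> ^ r = 1"] that by (auto simp: r_def)
  have red: "\<alpha> ^ k = \<alpha> ^ (k mod r)" for k
  proof -
    have "\<alpha> ^ (r * (k div r) + k mod r) = \<alpha> ^ (k mod r)"
      by (simp only: power_add power_mult r power_one mult_1_left)
    then show ?thesis by simp
  qed
  have inj: "inj_on (\<lambda>i. \<alpha> ^ i) {..<r}"
  proof (rule linorder_inj_onI)
    fix i j assume ij: "i < j" "i \<in> {..<r}" "j \<in> {..<r}"
    show "\<alpha> ^ i \<noteq> \<alpha> ^ j"
    proof
      assume "\<alpha> ^ i = \<alpha> ^ j"
      then have "\<alpha> ^ (j - i) = 1" using ij by (simp add: power_diff)
      then have "j - i = 0" using ij by (intro least) auto
      then show False using ij by simp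
    qed
  qed auto
  have img: "(\<lambda>i. \<alpha> ^ i) ` {..<r} = - {0}"
  proof (intro equalityI subsetI)
    fix x :: 'a assume "x \<in> - {0}"
    then obtain i :: nat where "x = \<alpha> ^ i" using exponent_exists by auto
    then have "x = \<alpha> ^ (i mod r)" using red by simp
    then show "x \<in> (\<lambda>i. \<alpha> ^ i) ` {..<r}" using r by auto
  qed auto
  have "r = w"
    using card_image[OF inj] by (simp add: img card_nonzero)
  then show "w > 0" "bij_betw (\<lambda>i. \<alpha> ^ i) {..<w} (- {0})"
    using r inj img by (auto simp: bij_betw_def)
  show "\<alpha> ^ k = 1 \<longleftrightarrow> w dvd k"
  proof
    assume "\<alpha> ^ k = 1"
    then have "k mod r = 0" using red[of k] r by (intro least) auto
    then show "w dvd k" using \<open>r = w\<close> by (simp add: mod_eq_0_iff_dvd)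
  next
    assume "w dvd k"
    then show "\<alpha> ^ k = 1" using red[of k] \<open>r = w\<close> by simp
  qed
qed

lemma alpha_power_eq_iff: "\<alpha> ^ i = \<alpha> ^ j \<longleftrightarrow> [i = j] (mod w)"
proof -
  have *: "\<alpha> ^ i = \<alpha> ^ j \<longleftrightarrow> [i = j] (mod w)" if "i \<le> j" for i j
  proof -
    have "\<alpha> ^ i = \<alpha> ^ j \<longleftrightarrow> \<alpha> ^ (j - i) = 1"
      using that by (auto simp: power_diff)
    then show ?thesis
      using that cong_altdef_nat'[of i j w] alpha_power_eq_1_iff by (simp add: cong_sym_eq nat_diff_distrib)
  qed
  show ?thesis
    using *[of i j] *[of j i] by (cases "i \<le> j") (auto simp: cong_sym_eq)
qed

lemma power_w: "(x::'a) \<noteq> 0 \<Longrightarrow> x ^ w = 1"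
  using exponent_exists[of x] alpha_power_eq_1_iff power_commutes
  by (metis dvd_triv_left mult.commute power_mult)

lemma sum_nonzero_eq: "(\<Sum>x\<in>- {0}. f x) = (\<Sum>i<w. f (\<alpha> ^ i))"
  using sum.reindex_bij_betw[OF bij_alpha_power, of f] by simp

definition nonzero_powers :: "nat \<Rightarrow> 'a set" where
  "nonzero_powers d = (\<lambda>y. y ^ d) ` (- {0})"

lemma nonzero_powers_eq_range: "nonzero_powers d = range (\<lambda>i. \<alpha> ^ (d * i))"
proof -
  have "- {0} = range (\<lambda>i::nat. \<alpha> ^ i)"
    using exponent_exists by auto
  then have "nonzero_powers d = range (\<lambda>i. (\<alpha> ^ i) ^ d)"
    by (simp add: nonzero_powers_def image_image)
  then show ?thesis
    by (simp add: mult.commute flip: power_mult)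
qed

lemma alpha_power_in_nonzero_powers:
  assumes "d dvd w"
  shows "\<alpha> ^ k \<in> nonzero_powers d \<longleftrightarrow> d dvd k"
proof
  assume "\<alpha> ^ k \<in> nonzero_powers d"
  then obtain i where "[k = d * i] (mod w)"
    by (auto simp: nonzero_powers_eq_range alpha_power_eq_iff)
  then have "[k = d * i] (mod d)"
    using assms by (rule cong_dvd_modulus_nat)
  then show "d dvd k"
    by (simp add: cong_dvd_iff)
next
  assume "d dvd k"
  then obtain i where "k = d * i" by blast
  then show "\<alpha> ^ k \<in> nonzero_powers d"
    by (simp add: nonzero_powers_eq_range)
qed

lemma nonzero_powers_nonzero: "x \<in> nonzero_powers d \<Longrightarrow> x \<noteq> 0"
  by (auto simp: nonzero_powers_def)

lemma nonzero_powers_mult: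
  "x \<in> nonzero_powers d \<Longrightarrow> y \<in> nonzero_powers d \<Longrightarrow> x * y \<in> nonzero_powers d"
proof -
  assume "x \<in> nonzero_powers d" "y \<in> nonzero_powers d"
  then obtain u v where "x = u ^ d" "y = v ^ d" "u \<noteq> 0" "v \<noteq> 0"
    by (auto simp: nonzero_powers_def)
  then show ?thesis
    by (auto simp: nonzero_powers_def power_mult_distrib intro!: image_eqI[of _ _ "u * v"])
qed

lemma nonzero_powers_inverse:
  "x \<in> nonzero_powers d \<Longrightarrow> inverse x \<in> nonzero_powers d"
proof -
  assume "x \<in> nonzero_powers d"
  then obtain u where "x = u ^ d" "u \<noteq> 0"
    by (auto simp: nonzero_powers_def)
  then show ?thesis
    by (auto simp: nonzero_powers_def power_inverse intro!: image_eqI[of _ _ "inverse u"])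
qed

lemma nonzero_powers_mult_iff:
  assumes "x \<in> nonzero_powers d"
  shows "x * y \<in> nonzero_powers d \<longleftrightarrow> y \<in> nonzero_powers d"
proof
  assume "x * y \<in> nonzero_powers d"
  then have "inverse x * (x * y) \<in> nonzero_powers d"
    using nonzero_powers_mult nonzero_powers_inverse[OF assms] by blast
  then show "y \<in> nonzero_powers d"
    using nonzero_powers_nonzero[OF assms] by (simp add: field_simps)
qed (use assms nonzero_powers_mult in auto)

lemma nonzero_powers_mono: "d dvd k \<Longrightarrow> nonzero_powers k \<subseteq> nonzero_powers d"
proof
  fix x assume "d dvd k" "x \<in> nonzero_powers k"
  then obtain c i where "k = d * c" "x = \<alpha> ^ (k * i)"
    unfolding nonzero_powers_eq_range by blast
  then show "x \<in> nonzero_powers d"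
    by (auto simp: nonzero_powers_eq_range mult.assoc)
qed

lemma roots_of_unity_eq_powers:
  assumes "k dvd w"
  shows "{x. x ^ k = 1} = nonzero_powers (w div k)"
proof -
  obtain c where c: "w = k * c" using assms by blast
  have k: "k > 0" and c0: "c > 0" using w_pos c by (auto intro: Nat.gr0I)
  have "x ^ k = 1 \<longleftrightarrow> x \<in> nonzero_powers c" for x :: 'a
  proof (cases "x = 0")
    case False
    then obtain i where i: "x = \<alpha> ^ i" using exponent_exists by blast
    have "x ^ k = 1 \<longleftrightarrow> k * c dvd k * i"
      by (simp add: i alpha_power_eq_1_iff c mult.commute flip: power_mult)
    also have "\<dots> \<longleftrightarrow> c dvd i" using k by simp
    also have "\<dots> \<longleftrightarrow> x \<in> nonzero_powers c"
      unfolding i by (subst alpha_power_in_nonzero_powers) (simp_all add: c)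
    finally show ?thesis .
  qed (use k nonzero_powers_nonzero in \<open>auto simp: power_0_left\<close>)
  then show ?thesis using c k by auto
qed

lemma card_roots_of_unity:
  assumes "k dvd w"
  shows "card {x::'a. x ^ k = 1} = k"
proof -
  obtain c where c: "w = k * c" using assms by blast
  have k: "k > 0" and c0: "c > 0" using w_pos c by (auto intro: Nat.gr0I)
  have "{x::'a. x ^ k = 1} = (\<lambda>i. \<alpha> ^ (c * i)) ` {..<k}"
  proof (intro equalityI subsetI)
    fix x :: 'a assume "x \<in> {x. x ^ k = 1}"
    then have "x \<in> nonzero_powers c"
      using roots_of_unity_eq_powers[OF assms] c k by simp
    then obtain i where "x = \<alpha> ^ (c * i)" by (auto simp: nonzero_powers_eq_range)
    moreover have "[c * i = c * (i mod k)] (mod w)"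
      using mult_mod_right[of c i k] unfolding c cong_def mult.commute[of k c] by simp
    ultimately have "x = \<alpha> ^ (c * (i mod k))"
      using alpha_power_eq_iff by metis
    then show "x \<in> (\<lambda>i. \<alpha> ^ (c * i)) ` {..<k}" using k by auto
  next
    fix x :: 'a assume "x \<in> (\<lambda>i. \<alpha> ^ (c * i)) ` {..<k}"
    then obtain i where "x = \<alpha> ^ (c * i)" by auto
    then show "x \<in> {x. x ^ k = 1}"
      by (simp add: alpha_power_eq_1_iff c flip: power_mult)
  qed
  moreover have "inj_on (\<lambda>i. \<alpha> ^ (c * i)) {..<k}"
  proof (rule inj_onI)
    fix i j assume ij: "i \<in> {..<k}" "j \<in> {..<k}" "\<alpha> ^ (c * i) = \<alpha> ^ (c * j)"
    then have "[c * i = c * j] (mod (k * c))"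
      by (simp add: alpha_power_eq_iff c)
    then have "c * i = c * j"
      by (rule cong_less_modulus_unique_nat) (use ij c0 in \<open>auto simp: mult.commute\<close>)
    then show "i = j" using c0 by simp
  qed
  ultimately show ?thesis by (simp add: card_image)
qed

lemma card_power_fibre:
  fixes z :: 'a
  assumes "k dvd w" "z \<noteq> 0"
  shows "card {x. x ^ k = z ^ k} = k"
proof -
  have "bij_betw (\<lambda>x. z * x) {x. x ^ k = 1} {x. x ^ k = z ^ k}"
    by (rule bij_betwI[of _ _ _ "\<lambda>x. x / z"])
       (use assms in \<open>auto simp: power_mult_distrib power_divide\<close>)
  then show ?thesis
    using card_roots_of_unity[OF assms(1)] bij_betw_same_card by fastforce
qed

text \<open>
  Each nonzero \<open>d\<close>-th power has exactly \<open>d\<close> roots, since the field contains all \<open>d\<close>-th roots of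
  unity.
\<close>
lemma sum_nonzero_power:
  fixes f :: "'a \<Rightarrow> 'c::comm_semiring_1"
  assumes "d dvd w"
  shows "(\<Sum>x\<in>- {0}. f (x ^ d)) = of_nat d * (\<Sum>y\<in>nonzero_powers d. f y)"
proof -
  have d: "d > 0" using assms w_pos by (auto intro: Nat.gr0I)
  have "(\<Sum>x\<in>- {0}. f (x ^ d)) =
        (\<Sum>y\<in>(\<lambda>x. x ^ d) ` (- {0}). \<Sum>x | x \<in> - {0} \<and> x ^ d = y. f (x ^ d))"
    by (rule sum.image_gen) simp
  also have "\<dots> = (\<Sum>y\<in>nonzero_powers d. of_nat d * f y)"
    unfolding nonzero_powers_def
  proof (intro sum.cong refl)
    fix y :: 'a assume "y \<in> (\<lambda>x. x ^ d) ` (- {0})"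
    then obtain z where z: "z \<noteq> 0" "y = z ^ d" by auto
    have "{x. x \<in> - {0} \<and> x ^ d = y} = {x. x ^ d = z ^ d}"
      using z d by (auto simp: power_0_left)
    then show "(\<Sum>x | x \<in> - {0} \<and> x ^ d = y. f (x ^ d)) = of_nat d * f y"
      using z card_power_fibre[OF assms z(1)] by simp
  qed
  finally show ?thesis by (simp add: sum_distrib_left)
qed

lemma card_nonzero_powers:
  assumes "d dvd w"
  shows "d * card (nonzero_powers d) = w"
  using sum_nonzero_power[OF assms, of "\<lambda>_. 1::nat"] card_nonzero by simp

text \<open>
  The set \<open>X\<close> is a union of cosets of the group of \<open>k\<close>-th roots of unity, and these cosets are the
  fibres of the \<open>k\<close>-th power map on \<open>X\<close>.
\<close>
lemma dvd_card_if_closed: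
  fixes X :: "'a set"
  assumes "k dvd w" "0 \<notin> X" and closed: "\<And>x z. x \<in> X \<Longrightarrow> z ^ k = 1 \<Longrightarrow> z * x \<in> X"
  shows "k dvd card X"
proof -
  have "card X = (\<Sum>x\<in>X. 1)" by simp
  also have "\<dots> = (\<Sum>y\<in>(\<lambda>x. x ^ k) ` X. \<Sum>x | x \<in> X \<and> x ^ k = y. 1)"
    by (rule sum.image_gen) simp
  also have "\<dots> = (\<Sum>y\<in>(\<lambda>x. x ^ k) ` X. k)"
  proof (intro sum.cong refl)
    fix y assume "y \<in> (\<lambda>x. x ^ k) ` X"
    then obtain z where z: "z \<in> X" "y = z ^ k" by auto
    then have z0: "z \<noteq> 0" using assms(2) by auto
    have "x \<in> X" if "x ^ k = z ^ k" for x
      using closed[OF z(1), of "x / z"] that z0 by (simp add: power_divide)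
    then have "{x. x \<in> X \<and> x ^ k = y} = {x. x ^ k = z ^ k}"
      using z by auto
    then show "(\<Sum>x | x \<in> X \<and> x ^ k = y. 1) = k"
      using card_power_fibre[OF assms(1) z0] by simp
  qed
  finally show ?thesis by simp
qed

end

section \<open>The canonical additive character\<close>

lemma pred_dvd_pred_power: "(a::nat) - 1 dvd a ^ n - 1"
proof (cases "a = 0")
  case False
  then have "[a = 1] (mod (a - 1))" by (simp add: cong_altdef_nat)
  then have "[a ^ n = 1] (mod (a - 1))" using cong_pow by fastforce
  then show ?thesis using False by (simp add: cong_altdef_nat Suc_leI)
qed (cases n; simp)

text \<open>
  A character that is not constantly \<open>1\<close> on a finite additive group sums to \<open>0\<close>, because
  translation by an element on which it differs from \<open>1\<close> multiplies the sum by that value.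
\<close>
lemma sum_nontrivial_character:
  fixes f :: "'a::ab_group_add \<Rightarrow> 'b::idom"
  assumes "finite V" and add: "\<And>u v. u \<in> V \<Longrightarrow> v \<in> V \<Longrightarrow> u + v \<in> V"
    and f: "\<And>u v. u \<in> V \<Longrightarrow> v \<in> V \<Longrightarrow> f (u + v) = f u * f v"
    and v: "v \<in> V" "f v \<noteq> 1"
  shows "(\<Sum>u\<in>V. f u) = 0"
proof -
  have inj: "inj_on ((+) v) V" by simp
  moreover have "(+) v ` V = V"
    using inj v add by (intro endo_inj_surj[OF assms(1)]) auto
  ultimately have bij: "bij_betw ((+) v) V V" by (simp add: bij_betw_def)
  have "(\<Sum>u\<in>V. f u) = (\<Sum>u\<in>V. f (v + u))"
    using sum.reindex_bij_betw[OF bij, of f] by simp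
  also have "\<dots> = f v * (\<Sum>u\<in>V. f u)"
    unfolding sum_distrib_left using v f by (intro sum.cong) auto
  finally have "(f v - 1) * (\<Sum>u\<in>V. f u) = 0" by (simp add: algebra_simps)
  then show ?thesis using v by simp
qed

locale finite_field_char = cyclic_field \<alpha> w for \<alpha> :: "'a::{field, finite}" and w +
  fixes p e :: nat
  assumes prime_p: "prime p" and e_pos: "e > 0" and card_field: "CARD('a) = p ^ e"
begin

lemma w_eq: "w = p ^ e - 1"
  by (simp add: w_def card_field)

lemma p_gt_1: "p > 1"
  using prime_p by (rule prime_gt_1_nat)

lemma CHAR_eq: "CHAR('a) = p"
proof -
  have "CHAR('a) > 0" by (rule finite_imp_CHAR_pos) simp
  then have "prime CHAR('a)" by (rule prime_CHAR_semidom)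
  moreover have "CHAR('a) dvd p ^ e"
    using CHAR_dvd_CARD[where 'a = 'a] card_field by simp
  ultimately show ?thesis
    using prime_p by (metis prime_dvd_power primes_dvd_imp_eq)
qed

lemma prime_CHAR: "prime CHAR('a)"
  using prime_p CHAR_eq by simp

lemma frobenius_add: "(x + y :: 'a) ^ (p ^ k) = x ^ (p ^ k) + y ^ (p ^ k)"
  by (rule freshmans_dream'[OF prime_CHAR]) (simp add: CHAR_eq)

lemma frobenius_sum: "(\<Sum>i\<in>A. f i :: 'a) ^ (p ^ k) = (\<Sum>i\<in>A. f i ^ (p ^ k))"
  by (rule freshmans_dream_sum'[OF prime_CHAR]) (simp add: CHAR_eq)

lemma frobenius_inj: "x ^ (p ^ k) = y ^ (p ^ k) \<Longrightarrow> (x :: 'a) = y"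
proof -
  assume *: "x ^ (p ^ k) = y ^ (p ^ k)"
  have "x ^ (p ^ k) = ((x - y) + y) ^ (p ^ k)" by simp
  also have "\<dots> = (x - y) ^ (p ^ k) + y ^ (p ^ k)" by (rule frobenius_add)
  finally show "x = y" using * by simp
qed

lemma power_card_field: "(x :: 'a) ^ (p ^ e) = x"
proof (cases "x = 0")
  case False
  have "x ^ (p ^ e) = x ^ w * x"
    using p_gt_1 by (simp add: w_eq flip: power_Suc2)
  then show ?thesis using power_w[OF False] by simp
qed (use p_gt_1 in auto)

abbreviation tr :: "'a \<Rightarrow> 'a" where
  "tr \<equiv> field_trace p e"

abbreviation \<psi> :: "'a \<Rightarrow> complex" where
  "\<psi> \<equiv> canonical_char p e"

lemma field_trace_add: "field_trace (p ^ s) m (x + y :: 'a) = field_trace (p ^ s) m x + field_trace (p ^ s) m y"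
  by (simp add: field_trace_def frobenius_add sum.distrib flip: power_mult)

lemma trace_add: "tr (x + y) = tr x + tr y"
  using field_trace_add[of 1 e x y] by simp

lemma field_trace_in_subfield:
  assumes "e = s * m"
  shows "(field_trace (p ^ s) m x :: 'a) ^ (p ^ s) = field_trace (p ^ s) m x"
proof -
  let ?q = "p ^ s"
  have m: "m > 0" using assms e_pos by (auto intro: Nat.gr0I)
  have "field_trace ?q m x ^ ?q = (\<Sum>i<m. x ^ (?q ^ Suc i))"
    by (simp add: field_trace_def frobenius_sum mult.commute flip: power_mult)
  also have "\<dots> = (\<Sum>i<Suc m. x ^ (?q ^ i)) - x"
    by (subst sum.lessThan_Suc_shift) simp
  also have "\<dots> = field_trace ?q m x + x ^ (p ^ e) - x"
    using assms by (simp add: field_trace_def flip: power_mult)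
  finally show ?thesis by (simp add: power_card_field)
qed

lemma trace_power_p: "tr x ^ p = tr x"
  using field_trace_in_subfield[of 1 e x] by simp

lemma subfield_eq_roots: "q > 1 \<Longrightarrow> {c::'a. c ^ q = c} = insert 0 {c. c ^ (q - 1) = 1}"
proof -
  assume q: "q > 1"
  have "c ^ q = c \<longleftrightarrow> c = 0 \<or> c ^ (q - 1) = 1" for c :: 'a
  proof -
    have "c ^ q = c * c ^ (q - 1)" using q by (simp flip: power_Suc)
    then show ?thesis by auto
  qed
  then show ?thesis by auto
qed

lemma subfield_order_dvd:
  assumes "e = s * m"
  shows "p ^ s - 1 dvd w"
  using pred_dvd_pred_power[of "p ^ s" m] assms by (simp add: w_eq power_mult)

lemma card_subfield:
  assumes "e = s * m"
  shows "card {c::'a. c ^ (p ^ s) = c} = p ^ s"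
proof -
  have "s > 0" using assms e_pos by (auto intro: Nat.gr0I)
  then have q: "p ^ s > 1" using p_gt_1 by (intro one_less_power)
  have "card {c::'a. c ^ (p ^ s) = c} = Suc (card {c::'a. c ^ (p ^ s - 1) = 1})"
    using q by (subst subfield_eq_roots[OF q], subst card_insert_disjoint) (auto simp: power_0_left)
  then show ?thesis
    using card_roots_of_unity[OF subfield_order_dvd[OF assms]] q by simp
qed

lemma prime_subfield_eq: "{c::'a. c ^ p = c} = of_nat ` {..<p}"
proof (rule sym, rule card_subset_eq)
  have pow: "of_nat k ^ p = (of_nat k :: 'a)" for k
  proof (induction k)
    case (Suc k)
    then show ?case using frobenius_add[of 1 "of_nat k" 1] by simp
  qed (use p_gt_1 in auto)
  then show "of_nat ` {..<p} \<subseteq> {c::'a. c ^ p = c}" by auto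
  have "inj_on (of_nat :: nat \<Rightarrow> 'a) {..<p}"
    by (intro inj_onI) (auto simp: of_nat_eq_iff_cong_CHAR CHAR_eq cong_def)
  then show "card (of_nat ` {..<p} :: 'a set) = card {c::'a. c ^ p = c}"
    using card_subfield[of 1 e] by (simp add: card_image)
qed simp

lemma exists_trace_rep: "\<exists>k<p. of_nat k = tr x"
proof -
  have "tr x \<in> {c. c ^ p = c}" using trace_power_p by simp
  then show ?thesis unfolding prime_subfield_eq by (metis imageE lessThan_iff)
qed

text \<open>
  The character can be read off any representative of the trace, not only the least one. This turns
  addition of traces into multiplication of roots of unity.
\<close>
lemma canonical_char_eq:
  assumes "of_nat k = tr x"
  shows "\<psi> x = exp (2 * of_real pi * \<i> * of_nat k / of_nat p)"
proof -
  obtain l where l: "l < p" "of_nat l = tr x" using exists_trace_rep by blast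
  have "prime_field_rep p (tr x) = l"
    unfolding prime_field_rep_def
  proof (rule the_equality)
    fix l' assume "l' < p \<and> of_nat l' = tr x"
    then have "l' < p" "(of_nat l' :: 'a) = of_nat l" using l by auto
    then have "[l' = l] (mod p)"
      using of_nat_eq_iff_cong_CHAR[where 'a = 'a, of l' l] by (simp only: CHAR_eq)
    then show "l' = l"
      using \<open>l' < p\<close> l(1) by (rule cong_less_modulus_unique_nat)
  qed (use l in auto)
  moreover have "[l = k] (mod p)"
    using l assms of_nat_eq_iff_cong_CHAR[where 'a = 'a, of l k] by (simp add: CHAR_eq)
  ultimately show ?thesis
    unfolding canonical_char_def
    using complex_root_unity_eq[of p l k] p_gt_1 by (simp add: cong_def)
qed

lemma char_eq_1_iff: "\<psi> x = 1 \<longleftrightarrow> tr x = 0"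
proof -
  obtain k where k: "of_nat k = tr x" using exists_trace_rep by blast
  have "\<psi> x = 1 \<longleftrightarrow> p dvd k"
    using canonical_char_eq[OF k] complex_root_unity_eq_1[of p k] p_gt_1 by simp
  also have "\<dots> \<longleftrightarrow> tr x = 0"
    using of_nat_eq_0_iff_char_dvd[where 'a = 'a, of k] k by (simp add: CHAR_eq)
  finally show ?thesis .
qed

lemma char_0 [simp]: "\<psi> 0 = 1"
  using p_gt_1 by (simp add: char_eq_1_iff field_trace_def power_0_left)

lemma char_add: "\<psi> (x + y) = \<psi> x * \<psi> y"
proof -
  obtain k l where kl: "of_nat k = tr x" "of_nat l = tr y"
    using exists_trace_rep by metis
  then have "of_nat (k + l) = tr (x + y)" by (simp add: trace_add)
  then show ?thesis
    using kl[THEN canonical_char_eq] canonical_char_eq[of "k + l" "x + y"]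
    by (simp add: add_divide_distrib ring_distribs flip: exp_add)
qed

lemma trace_frobenius: "tr (x ^ (p ^ k)) = tr x"
proof (induction k)
  case (Suc k)
  have "tr (x ^ (p ^ Suc k)) = tr (x ^ (p ^ k)) ^ p"
    using frobenius_sum[of "\<lambda>i. (x ^ (p ^ k)) ^ (p ^ i)" "{..<e}" 1]
    by (simp add: field_trace_def mult_ac flip: power_mult)
  then show ?case using Suc trace_power_p by simp
qed simp

lemma char_frobenius: "\<psi> (x ^ (p ^ k)) = \<psi> x"
proof -
  obtain l where "of_nat l = tr x" using exists_trace_rep by blast
  then show ?thesis
    using canonical_char_eq[of l x] canonical_char_eq[of l "x ^ (p ^ k)"] trace_frobenius by metis
qed

text \<open>
  Transitivity of the trace: grouping the exponents of Frobenius by their residue modulo \<open>s\<close>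
  factors the trace down to the prime field through the subfield with \<open>p ^ s\<close> elements.
\<close>
lemma trace_subfield_mult:
  assumes "e = s * m" and c: "c ^ (p ^ s) = c"
  shows "tr (c * x) = (\<Sum>k<s. (c * field_trace (p ^ s) m x) ^ (p ^ k))"
proof -
  have cl: "c ^ (p ^ (s * l)) = c" for l
  proof (induction l)
    case (Suc l)
    have "c ^ (p ^ (s * Suc l)) = (c ^ (p ^ (s * l))) ^ (p ^ s)"
      by (simp add: power_add mult.commute flip: power_mult)
    then show ?case using Suc c by simp
  qed simp
  have "tr (c * x) = (\<Sum>i<m * s. (c * x) ^ (p ^ i))"
    by (simp add: field_trace_def assms(1) mult.commute)
  also have "\<dots> = (\<Sum>l<m. \<Sum>i\<in>{l * s..<l * s + s}. (c * x) ^ (p ^ i))"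
    by (rule sum.nat_group[symmetric])
  also have "\<dots> = (\<Sum>l<m. \<Sum>k<s. (c * x) ^ (p ^ (l * s + k)))"
  proof (rule sum.cong[OF refl])
    fix l
    show "(\<Sum>i\<in>{l * s..<l * s + s}. (c * x) ^ (p ^ i)) = (\<Sum>k<s. (c * x) ^ (p ^ (l * s + k)))"
      using sum.shift_bounds_nat_ivl[of "\<lambda>i. (c * x) ^ (p ^ i)" 0 "l * s" s]
      by (simp add: atLeast0LessThan add.commute)
  qed
  also have "\<dots> = (\<Sum>l<m. \<Sum>k<s. (c * x ^ ((p ^ s) ^ l)) ^ (p ^ k))"
  proof (intro sum.cong refl)
    fix l k
    have "(c * x) ^ (p ^ (l * s + k)) = ((c * x) ^ (p ^ (s * l))) ^ (p ^ k)"
      by (simp add: power_add mult.commute flip: power_mult)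
    also have "\<dots> = (c * x ^ ((p ^ s) ^ l)) ^ (p ^ k)"
      unfolding power_mult_distrib cl by (simp add: power_mult)
    finally show "(c * x) ^ (p ^ (l * s + k)) = (c * x ^ ((p ^ s) ^ l)) ^ (p ^ k)" .
  qed
  also have "\<dots> = (\<Sum>k<s. \<Sum>l<m. (c * x ^ ((p ^ s) ^ l)) ^ (p ^ k))"
    by (rule sum.swap)
  also have "\<dots> = (\<Sum>k<s. (c * field_trace (p ^ s) m x) ^ (p ^ k))"
    by (simp add: field_trace_def sum_distrib_left frobenius_sum)
  finally show ?thesis .
qed

text \<open>
  The trace polynomial has smaller degree than the subfield has elements, so the trace does not
  vanish on it.
\<close>
lemma exists_nonzero_trace:
  assumes "e = s * m"
  shows "\<exists>c::'a. c ^ (p ^ s) = c \<and> (\<Sum>k<s. c ^ (p ^ k)) \<noteq> 0"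
proof (rule ccontr)
  assume *: "\<not> ?thesis"
  define f :: "'a poly" where "f = (\<Sum>k<s. Polynomial.monom 1 (p ^ k))"
  have s: "s > 0" using assms e_pos by (auto intro: Nat.gr0I)
  have "Polynomial.coeff f (p ^ (s - 1)) = (\<Sum>k<s. if k = s - 1 then 1 else 0)"
    unfolding f_def coeff_sum using p_gt_1 by (intro sum.cong) auto
  also have "\<dots> = 1" using s by simp
  finally have nz: "f \<noteq> 0" by auto
  have "Polynomial.degree f \<le> p ^ (s - 1)"
    unfolding f_def using p_gt_1
    by (intro degree_sum_le) (auto simp: degree_monom_eq power_increasing)
  also have "\<dots> < p ^ s" using s p_gt_1 by simp
  also have "p ^ s = card {c::'a. c ^ (p ^ s) = c}" using card_subfield[OF assms] by simp
  also have "\<dots> \<le> card {c. poly f c = 0}"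
    using * by (intro card_mono) (auto simp: f_def poly_sum poly_monom)
  also have "\<dots> \<le> Polynomial.degree f" by (rule card_poly_roots_bound[OF nz])
  finally show False by simp
qed

text \<open>
  Orthogonality relation over the subfield: by transitivity of the trace, \<open>c \<mapsto> \<psi> (c * x)\<close> is a
  character of the subfield, and it is trivial exactly when the relative trace of \<open>x\<close> is \<open>0\<close>. The
  case \<open>m = 1\<close> is orthogonality over the whole field, the case \<open>s = 1\<close> that over the prime field.
\<close>
lemma sum_char_subfield:
  fixes x :: 'a
  assumes "e = s * m"
  shows "(\<Sum>c | c ^ (p ^ s) = c. \<psi> (c * x)) =
         (if field_trace (p ^ s) m x = 0 then of_nat (p ^ s) else 0)"
proof (cases "field_trace (p ^ s) m x = 0")
  case True
  have "\<psi> (c * x) = 1" if "c ^ (p ^ s) = c" for c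
    using trace_subfield_mult[OF assms that, of x] True p_gt_1
    by (simp add: char_eq_1_iff power_0_left)
  then show ?thesis using True card_subfield[OF assms] by simp
next
  case False
  let ?T = "field_trace (p ^ s) m x"
  obtain b :: 'a where b: "b ^ (p ^ s) = b" "(\<Sum>k<s. b ^ (p ^ k)) \<noteq> 0"
    using exists_nonzero_trace[OF assms] by blast
  define c where "c = b / ?T"
  have c: "c ^ (p ^ s) = c"
    using b field_trace_in_subfield[OF assms, of x] by (simp add: c_def power_divide)
  have "c * ?T = b" using False by (simp add: c_def)
  then have "tr (c * x) \<noteq> 0"
    using trace_subfield_mult[OF assms c, of x] b by simp
  then have "\<psi> (c * x) \<noteq> 1" by (simp add: char_eq_1_iff)
  then have "(\<Sum>c | c ^ (p ^ s) = c. \<psi> (c * x)) = 0"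
    using c by (intro sum_nontrivial_character[where v = c])
      (auto simp: frobenius_add ring_distribs char_add)
  then show ?thesis using False by simp
qed

lemma sum_char_UNIV: "(\<Sum>c\<in>UNIV. \<psi> (c * x)) = (if x = 0 then of_nat (p ^ e) else 0)"
  using sum_char_subfield[of e 1 x] by (simp add: power_card_field field_trace_def)

end

section \<open>Counting free elements of trace zero\<close>

text \<open>
  The least common multiple of two divisors of \<open>N\<close> coprime to \<open>Q\<close> is another one, so the largest
  such divisor is a multiple of all the others.
\<close>
lemma coprime_part_properties:
  assumes "N > 0"
  shows coprime_part_dvd: "coprime_part N Q dvd N"
    and coprime_coprime_part: "coprime (coprime_part N Q) Q"
    and dvd_coprime_part: "k dvd N \<Longrightarrow> coprime k Q \<Longrightarrow> k dvd coprime_part N Q"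
proof -
  let ?S = "{k. k dvd N \<and> coprime k Q}"
  let ?K = "coprime_part N Q"
  have fin: "finite ?S" using assms by (intro finite_subset[OF _ finite_divisors_nat[of N]]) auto
  have "Max ?S \<in> ?S" using fin by (intro Max_in) (auto intro: exI[of _ 1])
  then show K: "?K dvd N" "coprime ?K Q" by (auto simp: coprime_part_def)
  assume k: "k dvd N" "coprime k Q"
  have "lcm k ?K dvd k * ?K" by (simp add: lcm_least)
  moreover have "coprime (k * ?K) Q" using k K by simp
  ultimately have "coprime (lcm k ?K) Q"
    using coprime_divisors[of "lcm k ?K" "k * ?K" Q Q] by simp
  then have "lcm k ?K \<in> ?S" using k K by (simp add: lcm_least)
  then have "lcm k ?K \<le> ?K"
    using Max_ge[OF fin] by (simp add: coprime_part_def)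
  moreover have "?K > 0" using K(1) assms by (auto intro: Nat.gr0I)
  moreover have "?K dvd lcm k ?K" by simp
  ultimately have "lcm k ?K = ?K"
    using k(1) assms by (metis dvd_imp_le dvd_0_left_iff gr0I lcm_eq_0_iff le_antisym not_gr_zero)
  then show "k dvd ?K" by (metis dvd_lcm1)
qed

text \<open>
  In a squarefree divisor of \<open>N\<close>, the primes dividing \<open>Q\<close> and those not dividing \<open>Q\<close> separate.
\<close>
lemma squarefree_dvd_gcd_times_coprime_part:
  assumes "N > 0" "squarefree d" "d dvd N"
  shows "d dvd gcd Q N * coprime_part N Q"
proof (rule squarefree_dvdI[OF assms(2)])
  fix l :: nat assume l: "prime l" "l dvd d"
  then have "l dvd N" using assms(3) by (rule_tac dvd_trans)
  show "l dvd gcd Q N * coprime_part N Q"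
  proof (cases "l dvd Q")
    case False
    then have "coprime l Q" using l(1) by (rule_tac prime_imp_coprime)
    then show ?thesis using dvd_coprime_part[OF assms(1) \<open>l dvd N\<close>] by simp
  qed (use \<open>l dvd N\<close> in simp)
qed

lemma sum_moebius_restrict:
  fixes f :: "nat \<Rightarrow> 'b::comm_ring_1"
  assumes "N > 0"
  shows "(\<Sum>d | d dvd N. of_int (moebius_mu d) * f d) =
         (\<Sum>d | d dvd gcd Q N * coprime_part N Q. of_int (moebius_mu d) * f d)"
proof (rule sum.mono_neutral_right)
  have "coprime (gcd Q N) (coprime_part N Q)"
    using coprime_coprime_part[OF assms, of Q]
      coprime_divisors[of "gcd Q N" Q "coprime_part N Q" "coprime_part N Q"]
    by (simp add: coprime_commute)
  then have "gcd Q N * coprime_part N Q dvd N"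
    using coprime_part_dvd[OF assms] by (intro divides_mult) auto
  then show "{d. d dvd gcd Q N * coprime_part N Q} \<subseteq> {d. d dvd N}"
    by (auto intro: dvd_trans)
  show "\<forall>d\<in>{d. d dvd N} - {d. d dvd gcd Q N * coprime_part N Q}. of_int (moebius_mu d) * f d = 0"
    using squarefree_dvd_gcd_times_coprime_part[OF assms] by (auto simp: moebius_mu_def)
qed (use assms in auto)

lemma sum_periodic:
  fixes h :: "nat \<Rightarrow> 'b::comm_semiring_1"
  assumes "\<And>i. h (i mod Q) = h i"
  shows "(\<Sum>i<r * Q. h i) = of_nat r * (\<Sum>i<Q. h i)"
proof -
  have "(\<Sum>i\<in>{l * Q..<l * Q + Q}. h i) = (\<Sum>i<Q. h i)" for l
  proof -
    have "(\<Sum>i\<in>{l * Q..<l * Q + Q}. h i) = (\<Sum>i<Q. h (l * Q + i))"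
      using sum.shift_bounds_nat_ivl[of h 0 "l * Q" Q] by (simp add: atLeast0LessThan add.commute)
    also have "\<dots> = (\<Sum>i<Q. h i)"
    proof (rule sum.cong[OF refl])
      fix i
      show "h (l * Q + i) = h i"
        using assms[of "l * Q + i"] assms[of i] by simp
    qed
    finally show ?thesis .
  qed
  then show ?thesis by (subst sum.nat_group[symmetric]) simp
qed

lemma sum_periodic_mult:
  fixes h :: "nat \<Rightarrow> 'b::comm_semiring_1"
  assumes per: "\<And>i. h (i mod Q) = h i" and "coprime b Q" "Q > 0" "Q dvd w"
  shows "(\<Sum>i<w. h (b * i)) = (\<Sum>i<w. h i)"
proof -
  obtain r where r: "w = r * Q" using assms(4) by (metis dvd_def mult.commute)
  have "inj_on (\<lambda>i. b * i mod Q) {..<Q}"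
  proof (rule inj_onI)
    fix i j assume ij: "i \<in> {..<Q}" "j \<in> {..<Q}" "b * i mod Q = b * j mod Q"
    then have "[i = j] (mod Q)"
      using cong_mult_lcancel_nat[OF assms(2), of i j] by (simp add: cong_def)
    then show "i = j" using ij by (simp add: cong_def)
  qed
  moreover have "(\<lambda>i. b * i mod Q) ` {..<Q} \<subseteq> {..<Q}"
    using assms(3) by auto
  ultimately have "bij_betw (\<lambda>i. b * i mod Q) {..<Q} {..<Q}"
    by (simp add: bij_betw_def endo_inj_surj)
  from sum.reindex_bij_betw[OF this, of h] have "(\<Sum>i<Q. h (b * i)) = (\<Sum>i<Q. h i)"
    by (simp add: per)
  moreover have "h (b * (i mod Q)) = h (b * i)" for i
    using per[of "b * (i mod Q)"] per[of "b * i"] by (simp add: mod_mult_right_eq)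
  ultimately show ?thesis
    unfolding r using sum_periodic[of h, OF per] sum_periodic[of "\<lambda>i. h (b * i)"] by simp
qed

context finite_field_char
begin

lemma N_free_alpha_power_iff:
  assumes "N dvd w"
  shows "N_free N (\<alpha> ^ k) \<longleftrightarrow> coprime N k"
proof -
  have N: "N > 0" using assms w_pos by (auto intro: Nat.gr0I)
  have "(\<exists>y. \<alpha> ^ k = y ^ d) \<longleftrightarrow> d dvd k" if "d dvd N" for d
  proof -
    have "d > 0" using that N by (auto intro: Nat.gr0I)
    then have "y \<noteq> 0" if "\<alpha> ^ k = y ^ d" for y
      using that by (metis alpha_nonzero power_eq_0_iff)
    then have "(\<exists>y. \<alpha> ^ k = y ^ d) \<longleftrightarrow> \<alpha> ^ k \<in> nonzero_powers d"
      unfolding nonzero_powers_def by blast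
    then show ?thesis
      using alpha_power_in_nonzero_powers[OF dvd_trans[OF that assms]] by simp
  qed
  then have "(d dvd N \<longrightarrow> (\<exists>y. \<alpha> ^ k = y ^ d) \<longrightarrow> d = 1) \<longleftrightarrow>
             (d dvd N \<longrightarrow> d dvd k \<longrightarrow> is_unit d)" for d
    by simp
  then show ?thesis by (simp add: N_free_def coprime_def)
qed

text \<open>
  Moebius inversion: a power of \<open>\<alpha>\<close> is \<open>N\<close>-free iff its exponent is coprime to \<open>N\<close>, and the divisors
  \<open>d\<close> of \<open>N\<close> that divide the exponent are those for which it is a \<open>d\<close>-th power.
\<close>
lemma count_N_free:
  assumes "N dvd w"
  shows "int (card {\<xi>. N_free N \<xi> \<and> P \<xi>}) =
         (\<Sum>d | d dvd N. moebius_mu d * int (card {\<xi> \<in> nonzero_powers d. P \<xi>}))"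
proof -
  have N: "N > 0" using assms w_pos by (auto intro: Nat.gr0I)
  have ind: "(\<Sum>d | d dvd N. moebius_mu d * of_bool (\<xi> \<in> nonzero_powers d)) = of_bool (N_free N \<xi>)"
    if nz: "\<xi> \<noteq> 0" for \<xi>
  proof -
    obtain k where k: "\<xi> = \<alpha> ^ k" using exponent_exists[OF nz] by blast
    have "(\<Sum>d | d dvd N. moebius_mu d * of_bool (\<xi> \<in> nonzero_powers d)) =
          (\<Sum>d | d dvd gcd N k. moebius_mu d)"
    proof (rule sum.mono_neutral_cong_right)
      show "\<forall>d\<in>{d. d dvd N} - {d. d dvd gcd N k}. moebius_mu d * of_bool (\<xi> \<in> nonzero_powers d) = 0"
      proof
        fix d assume "d \<in> {d. d dvd N} - {d. d dvd gcd N k}"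
        then show "moebius_mu d * of_bool (\<xi> \<in> nonzero_powers d) = 0"
          using alpha_power_in_nonzero_powers[OF dvd_trans[OF _ assms], of d k] by (simp add: k)
      qed
      show "moebius_mu d * of_bool (\<xi> \<in> nonzero_powers d) = moebius_mu d" if "d \<in> {d. d dvd gcd N k}" for d
        using alpha_power_in_nonzero_powers[OF dvd_trans[OF _ assms], of d k] that by (simp add: k)
    qed (use N in auto)
    also have "\<dots> = of_bool (gcd N k = 1)"
      using N by (subst sum_moebius) simp_all
    also have "gcd N k = 1 \<longleftrightarrow> N_free N \<xi>"
      unfolding k N_free_alpha_power_iff[OF assms] by (rule coprime_iff_gcd_eq_1[symmetric])
    finally show ?thesis .
  qed
  have "int (card {\<xi>. N_free N \<xi> \<and> P \<xi>}) = (\<Sum>\<xi>\<in>- {0::'a}. of_bool (N_free N \<xi>) * of_bool (P \<xi>))"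
  proof -
    have "- {0} \<inter> {\<xi>. N_free N \<xi> \<and> P \<xi>} = {\<xi>. N_free N \<xi> \<and> P \<xi>}"
      by (auto simp: N_free_def)
    then show ?thesis by (simp flip: of_bool_conj)
  qed
  also have "\<dots> = (\<Sum>\<xi>\<in>- {0}. \<Sum>d | d dvd N. moebius_mu d * (of_bool (\<xi> \<in> nonzero_powers d) * of_bool (P \<xi>)))"
  proof (rule sum.cong[OF refl])
    fix \<xi> :: 'a assume "\<xi> \<in> - {0}"
    then have "\<xi> \<noteq> 0" by simp
    then show "of_bool (N_free N \<xi>) * of_bool (P \<xi>) =
      (\<Sum>d | d dvd N. moebius_mu d * (of_bool (\<xi> \<in> nonzero_powers d) * of_bool (P \<xi>)))"
      unfolding ind[OF \<open>\<xi> \<noteq> 0\<close>, symmetric] sum_distrib_right by (simp only: mult.assoc)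
  qed
  also have "\<dots> = (\<Sum>d | d dvd N. moebius_mu d * (\<Sum>\<xi>\<in>- {0}. of_bool (\<xi> \<in> nonzero_powers d) * of_bool (P \<xi>)))"
    unfolding sum_distrib_left by (rule sum.swap)
  also have "\<dots> = (\<Sum>d | d dvd N. moebius_mu d * int (card {\<xi> \<in> nonzero_powers d. P \<xi>}))"
  proof (intro sum.cong refl arg_cong2[where f = "(*)"])
    fix d
    show "(\<Sum>\<xi>\<in>- {0}. of_bool (\<xi> \<in> nonzero_powers d) * of_bool (P \<xi>)) = int (card {\<xi> \<in> nonzero_powers d. P \<xi>})"
    proof -
      have "- {0} \<inter> {\<xi>. \<xi> \<in> nonzero_powers d \<and> P \<xi>} = {\<xi> \<in> nonzero_powers d. P \<xi>}"
        by (auto dest: nonzero_powers_nonzero)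
      then show ?thesis by (simp flip: of_bool_conj)
    qed
  qed
  finally show ?thesis .
qed

definition period :: "nat \<Rightarrow> complex" where
  "period d = (\<Sum>x\<in>nonzero_powers d. \<psi> x)"

lemma gaussian_period_0: "gaussian_period p e \<alpha> d 0 = period d"
  by (simp add: gaussian_period_def period_def nonzero_powers_eq_range power_mult)

lemma period_shift:
  assumes "c \<in> nonzero_powers d"
  shows "(\<Sum>x\<in>nonzero_powers d. \<psi> (c * x)) = period d"
proof -
  have "bij_betw (\<lambda>x. c * x) (nonzero_powers d) (nonzero_powers d)"
    by (rule bij_betwI[of _ _ _ "\<lambda>x. inverse c * x"])
       (use assms nonzero_powers_nonzero nonzero_powers_mult nonzero_powers_inverse
         in \<open>auto simp flip: mult.assoc\<close>)
  from sum.reindex_bij_betw[OF this, of \<psi>] show ?thesis by (simp add: period_def)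
qed

lemma field_trace_subfield_mult:
  fixes c x :: 'a
  assumes "c ^ q = c"
  shows "field_trace q m (c * x) = c * field_trace q m x"
proof -
  have "c ^ (q ^ i) = c" for i
    by (induction i) (simp_all add: power_mult assms)
  then show ?thesis
    by (simp add: field_trace_def power_mult_distrib sum_distrib_left)
qed

context
  fixes s m q Q :: nat
  assumes e_eq: "e = s * m" and q_eq: "q = p ^ s" and Q_eq: "Q = w div (q - 1)"
begin

lemma s_pos: "s > 0"
  using e_eq e_pos by (auto intro: Nat.gr0I)

lemma q_gt_1: "q > 1"
  using p_gt_1 s_pos unfolding q_eq by (intro one_less_power)

lemma w_factor: "w = Q * (q - 1)"
  using subfield_order_dvd[OF e_eq] by (simp add: Q_eq q_eq)

lemma Q_pos: "Q > 0"
  using w_factor w_pos by (auto intro: Nat.gr0I)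

lemma subfield_eq: "{c::'a. c ^ q = c} = insert 0 (nonzero_powers Q)"
proof -
  have "q - 1 dvd w" by (subst w_factor) simp
  then show ?thesis
    using subfield_eq_roots[OF q_gt_1] roots_of_unity_eq_powers[of "q - 1"]
    unfolding Q_eq by simp
qed

definition trace_zero_count :: "nat \<Rightarrow> nat" where
  "trace_zero_count d = card {x \<in> nonzero_powers d. field_trace q m x = 0}"

lemma trace_zero_count_eq_sum:
  assumes "d dvd w"
  shows "d * trace_zero_count d = (\<Sum>i<w. of_bool (field_trace q m (\<alpha> ^ (d * i)) = 0))"
proof -
  have "d * trace_zero_count d = d * (\<Sum>x\<in>nonzero_powers d. of_bool (field_trace q m x = 0))"
    by (simp add: trace_zero_count_def Int_def)
  also have "\<dots> = (\<Sum>x\<in>- {0::'a}. of_bool (field_trace q m (x ^ d) = 0))"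
    using sum_nonzero_power[OF assms, of "\<lambda>x. of_bool (field_trace q m x = 0) :: nat"]
    unfolding of_nat_id by (rule sym)
  finally show ?thesis
    by (simp only: sum_nonzero_eq power_mult[symmetric] mult.commute[of _ d])
qed

text \<open>
  The kernel of the trace is stable under the multiplicative group of the subfield, which
  consists of the \<open>Q\<close>-th powers. So whether \<open>\<alpha> ^ i\<close> has trace \<open>0\<close> depends on \<open>i\<close>
  modulo \<open>Q\<close> only, and a factor \<open>b\<close> coprime to \<open>Q\<close> permutes these residues.
\<close>
lemma trace_zero_count_coprime:
  assumes "a * b dvd w" "coprime b Q"
  shows "b * trace_zero_count (a * b) = trace_zero_count a"
proof -
  define h :: "nat \<Rightarrow> nat" where "h i = of_bool (field_trace q m (\<alpha> ^ (a * i)) = 0)" for i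
  have a: "a dvd w" "a > 0" using assms(1) w_pos by (auto intro: Nat.gr0I dvd_mult_left)
  have per: "h (i mod Q) = h i" for i
  proof -
    define c where "c = \<alpha> ^ (Q * (a * (i div Q)))"
    have "c \<in> nonzero_powers Q" by (auto simp: c_def nonzero_powers_eq_range)
    then have c: "c ^ q = c" "c \<noteq> 0"
      using subfield_eq nonzero_powers_nonzero by blast+
    have "a * i = Q * (a * (i div Q)) + a * (i mod Q)"
      by (metis add_mult_distrib2 mult.left_commute mult_div_mod_eq)
    then have "\<alpha> ^ (a * i) = c * \<alpha> ^ (a * (i mod Q))"
      by (simp add: c_def power_add)
    then show ?thesis
      using c by (simp add: h_def field_trace_subfield_mult)
  qed
  have "a * b * trace_zero_count (a * b) = (\<Sum>i<w. h (b * i))"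
    unfolding h_def mult.assoc[of a b, symmetric] by (rule trace_zero_count_eq_sum[OF assms(1)])
  also have "\<dots> = (\<Sum>i<w. h i)"
    using sum_periodic_mult[of h Q b w, OF per assms(2) Q_pos] by (simp add: w_factor)
  also have "\<dots> = a * trace_zero_count a"
    unfolding h_def by (rule trace_zero_count_eq_sum[OF a(1), symmetric])
  finally show ?thesis using a(2) by simp
qed

text \<open>
  Detecting trace zero by summing \<open>\<psi> (c * x)\<close> over the subfield: the term \<open>c = 0\<close> counts
  the \<open>d\<close>-th powers, and each \<open>c \<noteq> 0\<close> contributes one full period, being itself a
  \<open>d\<close>-th power because \<open>d\<close> divides \<open>Q\<close>.
\<close>
lemma trace_zero_count_period:
  assumes "d dvd Q"
  shows "of_nat q * of_nat (trace_zero_count d) =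
         of_nat w / of_nat d + (of_nat q - 1) * period d"
proof -
  have dw: "d dvd w" using assms w_factor by simp
  have d: "d > 0" using assms Q_pos by (auto intro: Nat.gr0I)
  have shift: "(\<Sum>x\<in>nonzero_powers d. \<psi> (c * x)) = period d" if "c \<in> nonzero_powers Q" for c
    using that nonzero_powers_mono[OF assms] by (intro period_shift) auto
  have card_subf: "card (nonzero_powers Q) = q - 1"
    using card_nonzero_powers[of Q] w_factor Q_pos by simp
  have card_d: "of_nat (card (nonzero_powers d)) = (of_nat w / of_nat d :: complex)"
    using card_nonzero_powers[OF dw] d by (simp add: field_simps flip: of_nat_mult)
  have "of_nat q * of_nat (trace_zero_count d) =
        (\<Sum>x\<in>nonzero_powers d. if field_trace q m x = 0 then of_nat q else (0::complex))"
    by (simp add: trace_zero_count_def sum.If_cases Int_def)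
  also have "\<dots> = (\<Sum>x\<in>nonzero_powers d. \<Sum>c | c ^ q = c. \<psi> (c * x))"
    unfolding q_eq sum_char_subfield[OF e_eq] ..
  also have "\<dots> = (\<Sum>c | c ^ q = c. \<Sum>x\<in>nonzero_powers d. \<psi> (c * x))"
    by (rule sum.swap)
  also have "\<dots> = of_nat (card (nonzero_powers d)) + (\<Sum>c\<in>nonzero_powers Q. period d)"
    unfolding subfield_eq using nonzero_powers_nonzero[of 0 Q]
    by (subst sum.insert) (auto simp: shift)
  also have "\<dots> = of_nat w / of_nat d + (of_nat q - 1) * period d"
    using q_gt_1 by (simp add: card_d card_subf of_nat_diff)
  finally show ?thesis .
qed

text \<open>
  The divisors of \<open>N\<close> that matter are products \<open>a * b\<close> with \<open>a\<close> dividing \<open>n\<close> and \<open>b\<close> dividing \<open>K\<close>.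
  The factor \<open>b\<close> only scales the count of trace-zero powers by \<open>1 / b\<close>, which produces
  \<open>totient K / K\<close>; the remaining sum over \<open>a\<close> becomes \<open>Delta\<close> through the periods.
\<close>
lemma Z_count_zero:
  assumes "N dvd w" and n: "n = gcd Q N" and K: "K = coprime_part N Q"
  shows "of_nat (Z_count q m N (0::'a)) =
           (of_nat q - 1) * of_nat (totient K) / (of_nat q * of_nat K) *
           (of_nat Q / of_nat n * of_nat (totient n) + Delta p e \<alpha> 0 n)"
proof -
  have N: "N > 0" using assms(1) w_pos by (auto intro: Nat.gr0I)
  have pos: "n > 0" "K > 0"
    using N coprime_part_dvd[OF N, of Q] by (auto simp: n K intro!: Nat.gr0I)
  have KQ: "coprime K Q" using coprime_coprime_part[OF N] by (simp add: K)
  have nK: "coprime n K"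
    using KQ coprime_divisors[of n Q K K] by (simp add: n coprime_commute)
  have nKw: "n * K dvd w"
    using nK coprime_part_dvd[OF N, of Q] assms(1) by (intro divides_mult) (auto simp: n K intro: dvd_trans)
  let ?t = trace_zero_count
  have "of_nat (Z_count q m N (0::'a)) = (of_int (int (Z_count q m N (0::'a))) :: complex)"
    by simp
  also have "\<dots> = (\<Sum>d | d dvd N. of_int (moebius_mu d) * of_nat (?t d))"
    unfolding Z_count_def using count_N_free[OF assms(1), of "\<lambda>x. field_trace q m x = 0"]
    by (simp add: trace_zero_count_def)
  also have "\<dots> = (\<Sum>d | d dvd n * K. of_int (moebius_mu d) * of_nat (?t d))"
    unfolding n K by (rule sum_moebius_restrict[OF N])
  also have "\<dots> = (\<Sum>a | a dvd n. \<Sum>b | b dvd K. of_int (moebius_mu (a * b)) * of_nat (?t (a * b)))"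
    by (rule sum_divisors_mult_coprime[OF nK pos])
  also have "\<dots> = (\<Sum>a | a dvd n. \<Sum>b | b dvd K.
                     (of_int (moebius_mu a) * of_nat (?t a)) * (of_int (moebius_mu b) / of_nat b))"
  proof (intro sum.cong refl)
    fix a b assume ab: "a \<in> {a. a dvd n}" "b \<in> {b. b dvd K}"
    then have "a * b dvd w" using nKw by (auto intro: dvd_trans mult_dvd_mono)
    moreover have "coprime b Q" "coprime a b"
      using ab KQ nK coprime_divisors[of b K Q Q] coprime_divisors[of a n b K] by auto
    moreover have "b > 0" using ab pos by (auto intro: Nat.gr0I)
    ultimately show "of_int (moebius_mu (a * b)) * of_nat (?t (a * b)) =
       (of_int (moebius_mu a) * of_nat (?t a)) * (of_int (moebius_mu b) / of_nat b :: complex)"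
      using trace_zero_count_coprime[of a b, symmetric] by (simp add: moebius_mu_mult_coprime)
  qed
  also have "\<dots> = (\<Sum>a | a dvd n. of_int (moebius_mu a) * of_nat (?t a)) * (of_nat (totient K) / of_nat K)"
    unfolding sum_moebius_div[OF pos(2), symmetric] by (rule sum_product[symmetric])
  also have "(\<Sum>a | a dvd n. of_int (moebius_mu a) * of_nat (?t a)) =
             (\<Sum>a | a dvd n. of_nat w / of_nat q * (of_int (moebius_mu a) / of_nat a) +
                (of_nat q - 1) / of_nat q * (of_int (moebius_mu a) * gaussian_period p e \<alpha> a 0))"
  proof (intro sum.cong refl)
    fix a assume "a \<in> {a. a dvd n}"
    then have "a dvd Q" by (auto simp: n)
    from trace_zero_count_period[OF this]
    have "of_nat (?t a) = (of_nat w / of_nat a + (of_nat q - 1) * period a) / (of_nat q :: complex)"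
      using q_gt_1 by (simp add: field_simps)
    then show "of_int (moebius_mu a) * of_nat (?t a) =
        of_nat w / of_nat q * (of_int (moebius_mu a) / of_nat a) +
        (of_nat q - 1) / of_nat q * (of_int (moebius_mu a) * gaussian_period p e \<alpha> a 0)"
      by (simp add: gaussian_period_0 ring_distribs add_divide_distrib mult_ac)
  qed
  also have "\<dots> = of_nat w / of_nat q * (of_nat (totient n) / of_nat n) +
                 (of_nat q - 1) / of_nat q * Delta p e \<alpha> 0 n"
    unfolding sum.distrib sum_distrib_left[symmetric] sum_moebius_div[OF pos(1)] Delta_def ..
  also have "of_nat w = of_nat Q * (of_nat q - 1 :: complex)"
    using q_gt_1 by (simp add: w_factor of_nat_diff)
  also have "(of_nat Q * (of_nat q - 1) / of_nat q * (of_nat (totient n) / of_nat n) +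
                 (of_nat q - 1) / of_nat q * Delta p e \<alpha> 0 n) * (of_nat (totient K) / of_nat K) =
             (of_nat q - 1) * of_nat (totient K) / (of_nat q * of_nat K) *
               (of_nat Q / of_nat n * of_nat (totient n) + Delta p e \<alpha> 0 n)"
  proof -
    have "(a * c / b * (x / y) + c / b * z) * (u / v) = c * u / (b * v) * (a / y * x + z)"
      for a b c x y z u v :: complex
      by (simp add: divide_inverse algebra_simps)
    then show ?thesis .
  qed
  finally show ?thesis .
qed

end

end

section \<open>Semiprimitive Gaussian periods\<close>

context finite_field_char
begin

context
  fixes j g P M :: nat
  assumes j_pos: "j > 0" and e_eq: "e = 2 * j * g" and P_eq: "P = p ^ j" and M_eq: "M = P + 1"
begin

lemma P_gt_1: "P > 1"
  unfolding P_eq using p_gt_1 j_pos by (intro one_less_power)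

lemma card_eq: "p ^ e = (P\<^sup>2) ^ g"
  by (simp add: e_eq P_eq mult_ac flip: power_mult)

lemma square_pred: "P\<^sup>2 - 1 = (P - 1) * M"
  by (simp add: M_eq power2_eq_square algebra_simps)

lemma square_pred_dvd_w: "P\<^sup>2 - 1 dvd w"
  unfolding w_eq card_eq by (rule pred_dvd_pred_power)

lemma pred_p_dvd: "p - 1 dvd P - 1"
  unfolding P_eq by (rule pred_dvd_pred_power)

lemma M_times_dvd_w: "M * (p - 1) dvd w"
proof -
  have "M * (p - 1) dvd (P - 1) * M"
    using pred_p_dvd by (simp add: mult.commute)
  then show ?thesis using square_pred_dvd_w square_pred by (metis dvd_trans)
qed

lemma M_dvd_w: "M dvd w"
  using M_times_dvd_w by (rule dvd_mult_left)

text \<open>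
  The trace of \<open>a * x ^ (P + 1)\<close> down to the subfield with \<open>P\<close> elements is a Hermitian form over the
  subfield with \<open>P\<^sup>2\<close> elements.
\<close>
definition hermitian_sum :: "'a \<Rightarrow> complex" where
  "hermitian_sum a = (\<Sum>x\<in>UNIV. \<psi> (a * x ^ M))"

lemma hermitian_sum_eq_nonzero: "hermitian_sum a = 1 + (\<Sum>x\<in>- {0}. \<psi> (a * x ^ M))"
proof -
  have "(UNIV :: 'a set) = insert 0 (- {0})" by auto
  then have "hermitian_sum a = (\<Sum>x\<in>insert 0 (- {0}). \<psi> (a * x ^ M))"
    unfolding hermitian_sum_def by metis
  then show ?thesis by (simp add: M_eq)
qed

text \<open>A nonzero element of the prime field is an \<open>M\<close>-th power and can be absorbed into \<open>x ^ M\<close>.\<close>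
lemma hermitian_sum_mult_prime_field:
  assumes "c ^ (p - 1) = 1"
  shows "hermitian_sum (c * a) = hermitian_sum a"
proof -
  have pw: "p - 1 dvd w" using M_times_dvd_w by (rule dvd_mult_right)
  obtain r where "w = M * (p - 1) * r" using M_times_dvd_w by blast
  then have "w = (p - 1) * (M * r)" by (simp only: mult_ac)
  then have "w div (p - 1) = M * r" using p_gt_1 by simp
  then have "nonzero_powers (w div (p - 1)) \<subseteq> nonzero_powers M"
    by (intro nonzero_powers_mono) simp
  moreover have "c \<in> nonzero_powers (w div (p - 1))"
    using roots_of_unity_eq_powers[OF pw] assms by blast
  ultimately obtain y where y: "y \<noteq> 0" "c = y ^ M"
    unfolding nonzero_powers_def by blast
  have bij: "bij_betw (\<lambda>x. y * x) UNIV UNIV"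
    by (rule bij_betwI[of _ _ _ "\<lambda>x. x / y"]) (use y in auto)
  have "hermitian_sum (c * a) = (\<Sum>x\<in>UNIV. \<psi> (a * (y * x) ^ M))"
    by (simp add: hermitian_sum_def y power_mult_distrib mult_ac)
  also have "\<dots> = hermitian_sum a"
    unfolding hermitian_sum_def using sum.reindex_bij_betw[OF bij, of "\<lambda>x. \<psi> (a * x ^ M)"] .
  finally show ?thesis .
qed

text \<open>In particular \<open>- 1\<close> is an \<open>M\<close>-th power. Since \<open>\<psi> (- x)\<close> is conjugate to \<open>\<psi> x\<close>, the sum is real.\<close>
lemma hermitian_sum_uminus: "hermitian_sum (- a) = hermitian_sum a"
proof -
  have "(- 1 :: 'a) ^ (p - 1) = 1"
  proof (cases "p = 2")
    case True
    then have "(- 1 :: 'a) = 1" by (intro uminus_CHAR_2) (simp add: CHAR_eq)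
    then show ?thesis by (simp only: power_one)
  next
    case False
    then have "odd p" using prime_p p_gt_1 by (intro prime_odd_nat) linarith+
    then show ?thesis by simp
  qed
  from hermitian_sum_mult_prime_field[OF this, of a] show ?thesis by simp
qed

text \<open>
  Summing \<open>hermitian_sum\<close> over the multiples of \<open>a\<close> by the prime field counts the \<open>x\<close> with \<open>a * x ^ M\<close>
  of trace \<open>0\<close>. These \<open>x\<close> form a union of cosets of the group of order \<open>M * (p - 1)\<close>
  whose \<open>M\<close>-th powers lie in the prime field.
\<close>
lemma hermitian_sum_integral: "\<exists>k::int. hermitian_sum a = 1 + of_nat M * of_int k"
proof -
  define X where "X = {x. x \<noteq> 0 \<and> tr (a * x ^ M) = 0}"
  have "M * (p - 1) dvd card X"
  proof (rule dvd_card_if_closed[OF M_times_dvd_w])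
    fix x z :: 'a assume x: "x \<in> X" and z: "z ^ (M * (p - 1)) = 1"
    have M0: "M > 0" by (simp add: M_eq)
    have "(z ^ M) ^ (p - 1) = 1" using z by (simp only: power_mult[symmetric])
    moreover have "z ^ M * (z ^ M) ^ (p - 1) = (z ^ M) ^ p"
      using p_gt_1 by (simp flip: power_Suc)
    ultimately have "(z ^ M) ^ p = z ^ M" by simp
    then have "tr (z ^ M * (a * x ^ M)) = z ^ M * tr (a * x ^ M)"
      by (rule field_trace_subfield_mult)
    moreover have "z \<noteq> 0" using z M0 p_gt_1 by (auto simp: power_0_left)
    ultimately show "z * x \<in> X"
      using x by (auto simp: X_def power_mult_distrib mult_ac)
  qed (auto simp: X_def)
  then obtain k where k: "card X = M * (p - 1) * k" by blast
  obtain r where r: "w = M * (p - 1) * r" using M_times_dvd_w by blast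
  have eq1: "e = 1 * e" by simp
  have sub: "{c::'a. c ^ p = c} = insert 0 {c. c ^ (p - 1) = 1}"
    by (rule subfield_eq_roots[OF p_gt_1])
  have pw: "p - 1 dvd w" using M_times_dvd_w by (rule dvd_mult_right)
  have card_r: "card {c::'a. c ^ (p - 1) = 1} = p - 1"
    by (rule card_roots_of_unity[OF pw])
  have "of_nat w + of_nat (p - 1) * (hermitian_sum a - 1) =
        (\<Sum>c | c ^ p = c. \<Sum>x\<in>- {0}. \<psi> (c * (a * x ^ M)))"
  proof -
    have "(\<Sum>x\<in>- {0}. \<psi> (c * (a * x ^ M))) = hermitian_sum a - 1" if "c ^ (p - 1) = 1" for c
      using hermitian_sum_mult_prime_field[OF that, of a] hermitian_sum_eq_nonzero[of "c * a"]
      by (simp add: mult.assoc eq_diff_eq add.commute)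
    then have "(\<Sum>c | c ^ (p - 1) = 1. \<Sum>x\<in>- {0}. \<psi> (c * (a * x ^ M))) = of_nat (p - 1) * (hermitian_sum a - 1)"
      using card_r by simp
    moreover have "(0::'a) \<notin> {c. c ^ (p - 1) = 1}" using p_gt_1 by (simp add: power_0_left)
    ultimately show ?thesis
      unfolding sub by (subst sum.insert) (auto simp: card_nonzero)
  qed
  also have "\<dots> = (\<Sum>x\<in>- {0}. \<Sum>c | c ^ p = c. \<psi> (c * (a * x ^ M)))"
    by (rule sum.swap)
  also have "\<dots> = (\<Sum>x\<in>- {0}. if tr (a * x ^ M) = 0 then of_nat p else 0)"
    using sum_char_subfield[OF eq1] unfolding power_one_right by simp
  also have "\<dots> = of_nat p * of_nat (card X)"
  proof -
    have "- {0} \<inter> {x. tr (a * x ^ M) = 0} = X" by (auto simp: X_def)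
    then show ?thesis by (simp add: sum.If_cases)
  qed
  finally have "of_nat w + of_nat (p - 1) * (hermitian_sum a - 1) = of_nat p * of_nat (card X)" .
  then have "of_nat (p - 1) * (hermitian_sum a - 1) =
             of_nat (p - 1) * (of_nat M * (of_nat p * of_nat k - of_nat r))"
    unfolding k r of_nat_mult by (simp add: algebra_simps)
  then have "hermitian_sum a - 1 = of_nat M * (of_nat p * of_nat k - of_nat r)"
    using p_gt_1 by (subst (asm) mult_cancel_left) simp
  then have "hermitian_sum a = 1 + of_nat M * of_int (int p * int k - int r)" by (simp add: algebra_simps)
  then show ?thesis by blast
qed

text \<open>
  The radical of the bilinear form that polarises \<open>x \<mapsto> tr (a * x ^ M)\<close>. Being a subspace of
  dimension at most one over the subfield with \<open>P\<^sup>2\<close> elements, it has \<open>1\<close> or \<open>P\<^sup>2\<close> elements.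
\<close>
definition form_kernel :: "'a \<Rightarrow> 'a set" where
  "form_kernel a = {z. a * z + a ^ P * z ^ (P\<^sup>2) = 0}"

text \<open>
  On the kernel, \<open>u = a * z ^ M\<close> satisfies \<open>u ^ P = - u\<close>, so in its trace the conjugates
  \<open>u ^ (p ^ i)\<close> and \<open>u ^ (p ^ (i + j))\<close> cancel.
\<close>
lemma char_kernel:
  assumes "z \<in> form_kernel a"
  shows "\<psi> (a * z ^ M) = 1"
proof -
  define u where "u = a * z ^ M"
  have "u ^ P = z ^ P * (a ^ P * z ^ (P\<^sup>2))"
    by (simp add: u_def M_eq power_mult_distrib power2_eq_square power_add mult_ac flip: power_mult)
  also have "a ^ P * z ^ (P\<^sup>2) = - (a * z)"
    using assms by (simp add: form_kernel_def eq_neg_iff_add_eq_0 add.commute)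
  finally have uP: "u ^ P = - u" by (simp add: u_def M_eq mult_ac)
  have neg: "u ^ (p ^ (i + j)) = - (u ^ (p ^ i))" for i
  proof -
    have "u ^ (p ^ (i + j)) = (u ^ P) ^ (p ^ i)"
      by (simp add: P_eq power_add mult.commute flip: power_mult)
    also have "\<dots> + u ^ (p ^ i) = (- u + u) ^ (p ^ i)"
      unfolding uP by (rule frobenius_add[symmetric])
    finally show ?thesis using p_gt_1 by (simp add: eq_neg_iff_add_eq_0)
  qed
  have block: "(\<Sum>i\<in>{l * (2 * j)..<l * (2 * j) + 2 * j}. u ^ (p ^ i)) = 0" for l
  proof -
    let ?b = "l * (2 * j)"
    have "(\<Sum>i\<in>{?b..<?b + 2 * j}. u ^ (p ^ i)) =
          (\<Sum>i\<in>{?b..<?b + j}. u ^ (p ^ i)) + (\<Sum>i\<in>{?b + j..<?b + j + j}. u ^ (p ^ i))"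
    proof -
      have *: "?b + 2 * j = ?b + j + j" by simp
      show ?thesis unfolding * by (rule sum.atLeastLessThan_concat[symmetric]) simp_all
    qed
    also have "(\<Sum>i\<in>{?b + j..<?b + j + j}. u ^ (p ^ i)) = (\<Sum>i\<in>{?b..<?b + j}. u ^ (p ^ (i + j)))"
      by (rule sum.shift_bounds_nat_ivl)
    finally show ?thesis by (simp add: neg sum_negf)
  qed
  have "tr u = (\<Sum>i<g * (2 * j). u ^ (p ^ i))"
    by (simp add: field_trace_def e_eq mult_ac)
  also have "\<dots> = 0"
    unfolding sum.nat_group[symmetric] block by simp
  finally show ?thesis by (simp add: char_eq_1_iff u_def)
qed

text \<open>
  Completing the square of the Hermitian form: after the substitution
  \<open>x = y + z\<close>, the sum over \<open>y\<close> is that of a linear character, which vanishes unless \<open>z\<close>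
  lies in the kernel of the form.
\<close>
lemma hermitian_sum_square: "(hermitian_sum a)\<^sup>2 = of_nat (p ^ e) * of_nat (card (form_kernel a))"
proof -
  have expand: "\<psi> (a * (z + y) ^ M) * \<psi> (- (a * y ^ M)) =
        \<psi> (a * z ^ M) * \<psi> (y ^ P * (a * z + a ^ P * z ^ (P\<^sup>2)))" for y z
  proof -
    have "a * (z + y) ^ M - a * y ^ M = a * z ^ M + y ^ P * (a * z) + a * y * z ^ P"
      using frobenius_add[of z y j] by (simp add: M_eq P_eq algebra_simps)
    then have "\<psi> (a * (z + y) ^ M) * \<psi> (- (a * y ^ M)) =
               \<psi> (a * z ^ M) * \<psi> (y ^ P * (a * z)) * \<psi> (a * y * z ^ P)"
      by (simp flip: char_add)
    also have "\<psi> (a * y * z ^ P) = \<psi> ((a * y * z ^ P) ^ (p ^ j))"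
      by (rule char_frobenius[symmetric])
    also have "(a * y * z ^ P) ^ (p ^ j) = y ^ P * (a ^ P * z ^ (P\<^sup>2))"
      by (simp add: P_eq power_mult_distrib power2_eq_square mult_ac flip: power_mult)
    finally show ?thesis by (simp add: ring_distribs char_add mult.assoc)
  qed
  have inj: "inj (\<lambda>y::'a. y ^ P)"
    unfolding P_eq by (rule injI) (rule frobenius_inj)
  then have bij: "bij_betw (\<lambda>y::'a. y ^ P) UNIV UNIV"
    using endo_inj_surj[OF _ _ inj] by (simp add: bij_betw_def)
  have inner: "(\<Sum>y\<in>UNIV. \<psi> (y ^ P * b)) = (if b = 0 then of_nat (p ^ e) else 0)" for b
    using sum.reindex_bij_betw[OF bij, of "\<lambda>y. \<psi> (y * b)"] sum_char_UNIV[of b] by simp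
  have "(hermitian_sum a)\<^sup>2 = (\<Sum>y\<in>UNIV. \<Sum>x\<in>UNIV. \<psi> (a * x ^ M) * \<psi> (- (a * y ^ M)))"
  proof -
    have "(hermitian_sum a)\<^sup>2 = hermitian_sum a * hermitian_sum (- a)" by (simp add: hermitian_sum_uminus power2_eq_square)
    also have "\<dots> = (\<Sum>x\<in>UNIV. \<Sum>y\<in>UNIV. \<psi> (a * x ^ M) * \<psi> (- (a * y ^ M)))"
      by (simp add: hermitian_sum_def sum_product)
    also have "\<dots> = (\<Sum>y\<in>UNIV. \<Sum>x\<in>UNIV. \<psi> (a * x ^ M) * \<psi> (- (a * y ^ M)))"
      by (rule sum.swap)
    finally show ?thesis .
  qed
  also have "\<dots> = (\<Sum>y\<in>UNIV. \<Sum>z\<in>UNIV. \<psi> (a * (z + y) ^ M) * \<psi> (- (a * y ^ M)))"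
  proof (rule sum.cong[OF refl])
    fix y :: 'a
    have "bij_betw (\<lambda>z. z + y) UNIV UNIV"
      by (rule bij_betwI[of _ _ _ "\<lambda>x. x - y"]) auto
    from sum.reindex_bij_betw[OF this, of "\<lambda>x. \<psi> (a * x ^ M) * \<psi> (- (a * y ^ M))"]
    show "(\<Sum>x\<in>UNIV. \<psi> (a * x ^ M) * \<psi> (- (a * y ^ M))) =
          (\<Sum>z\<in>UNIV. \<psi> (a * (z + y) ^ M) * \<psi> (- (a * y ^ M)))" by (rule sym)
  qed
  also have "\<dots> = (\<Sum>z\<in>UNIV. \<Sum>y\<in>UNIV. \<psi> (a * z ^ M) * \<psi> (y ^ P * (a * z + a ^ P * z ^ (P\<^sup>2))))"
    unfolding expand by (rule sum.swap)
  also have "\<dots> = (\<Sum>z\<in>UNIV. \<psi> (a * z ^ M) * (if z \<in> form_kernel a then of_nat (p ^ e) else 0))"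
    unfolding sum_distrib_left[symmetric] inner form_kernel_def mem_Collect_eq ..
  also have "\<dots> = (\<Sum>z\<in>UNIV. if z \<in> form_kernel a then of_nat (p ^ e) else 0)"
    by (intro sum.cong refl) (simp add: char_kernel)
  also have "\<dots> = of_nat (p ^ e) * of_nat (card (form_kernel a))"
    by (simp add: sum.If_cases)
  finally show ?thesis .
qed

text \<open>
  A nonzero \<open>z\<close> of the kernel satisfies \<open>z ^ (P\<^sup>2 - 1) = - (1 / a ^ (P - 1))\<close>, and any two such
  differ by a factor from the subfield with \<open>P\<^sup>2\<close> elements.
\<close>
lemma card_kernel:
  assumes "a \<noteq> 0"
  shows "card (form_kernel a) = (if \<exists>z. z \<noteq> 0 \<and> (a * z ^ M) ^ (P - 1) = - 1 then P\<^sup>2 else 1)"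
proof -
  have P2: "P\<^sup>2 - 1 > 0" unfolding square_pred using P_gt_1 by (simp add: M_eq)
  have iff: "z \<in> form_kernel a \<longleftrightarrow> (a * z ^ M) ^ (P - 1) = - 1" if "z \<noteq> 0" for z
  proof -
    have "a ^ P = a * a ^ (P - 1)" "z ^ (P\<^sup>2) = z * z ^ (P\<^sup>2 - 1)"
      using P_gt_1 by (simp_all flip: power_Suc)
    then have "a * z + a ^ P * z ^ (P\<^sup>2) = (a * z) * (1 + a ^ (P - 1) * z ^ (P\<^sup>2 - 1))"
      by (simp add: algebra_simps)
    also have "a ^ (P - 1) * z ^ (P\<^sup>2 - 1) = (a * z ^ M) ^ (P - 1)"
      unfolding square_pred power_mult_distrib by (simp only: power_mult[symmetric] mult.commute)
    finally show ?thesis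
      using assms that by (simp add: form_kernel_def eq_neg_iff_add_eq_0 add.commute)
  qed
  have k0: "0 \<in> form_kernel a" using P_gt_1 by (simp add: form_kernel_def power_0_left)
  show ?thesis
  proof (cases "\<exists>z. z \<noteq> 0 \<and> (a * z ^ M) ^ (P - 1) = - 1")
    case False
    then have "form_kernel a = {0}" using iff k0 by auto
    then show ?thesis unfolding if_not_P[OF False] by simp
  next
    case True
    then obtain z0 where z0: "z0 \<noteq> 0" "(a * z0 ^ M) ^ (P - 1) = - 1" by blast
    have "z \<in> form_kernel a \<longleftrightarrow> z = 0 \<or> z ^ (P\<^sup>2 - 1) = z0 ^ (P\<^sup>2 - 1)" for z
    proof (cases "z = 0")
      case z: False
      have ex: "(a * y ^ M) ^ (P - 1) = a ^ (P - 1) * y ^ (P\<^sup>2 - 1)" for y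
        unfolding square_pred power_mult_distrib by (simp only: power_mult[symmetric] mult.commute)
      show ?thesis
        using z iff[OF z] z0 assms unfolding ex by (metis mult_left_cancel power_not_zero)
    qed (use k0 in simp)
    then have "form_kernel a = insert 0 {z. z ^ (P\<^sup>2 - 1) = z0 ^ (P\<^sup>2 - 1)}" by auto
    moreover have "0 \<notin> {z. z ^ (P\<^sup>2 - 1) = z0 ^ (P\<^sup>2 - 1)}"
      using P2 z0 by (simp add: power_0_left)
    ultimately have "card (form_kernel a) = Suc (P\<^sup>2 - 1)"
      using card_power_fibre[OF square_pred_dvd_w z0(1)] by simp
    then show ?thesis using True P2 by simp
  qed
qed

text \<open>
  The square of \<open>hermitian_sum a\<close> is now known, and its sign follows from
  \<open>hermitian_sum a \<equiv> 1\<close> modulo \<open>M\<close> together with \<open>P \<equiv> - 1\<close> modulo \<open>M\<close>.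
\<close>
lemma hermitian_sum_value:
  assumes "a \<noteq> 0"
  shows "hermitian_sum a = (if \<exists>z. z \<noteq> 0 \<and> (a * z ^ M) ^ (P - 1) = - 1
                then - ((-1) ^ g * of_nat P ^ (g + 1)) else (-1) ^ g * of_nat P ^ g)"
proof -
  obtain k :: int where k: "hermitian_sum a = 1 + of_nat M * of_int k" using hermitian_sum_integral by blast
  define t :: int where "t = 1 + int M * k"
  have S_t: "hermitian_sum a = of_int t" by (simp add: t_def k)
  have sq: "t\<^sup>2 = int (P ^ (2 * g)) * int (card (form_kernel a))"
  proof -
    have "(of_int (t\<^sup>2) :: complex) = of_int (int (P ^ (2 * g)) * int (card (form_kernel a)))"
      using hermitian_sum_square[of a] by (simp add: S_t card_eq power_mult)
    then show ?thesis by (simp only: of_int_eq_iff)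
  qed
  have sign: "t = (- int P) ^ i" if "t\<^sup>2 = (int P ^ i)\<^sup>2" for i
  proof -
    have "- int P - 1 = int M * (- 1)" by (simp add: M_eq)
    then have c: "[- int P = 1] (mod int M)" unfolding cong_iff_dvd_diff by (metis dvd_triv_left)
    then have c1: "[(- int P) ^ i = 1] (mod int M)" using cong_pow by fastforce
    have c2: "[t = 1] (mod int M)" by (simp add: t_def cong_iff_dvd_diff)
    have "t\<^sup>2 = ((- int P) ^ i)\<^sup>2"
      using that by (simp add: power_minus_mult power_mult_distrib power_minus[of "int P"] flip: power_mult)
    then have "t = (- int P) ^ i \<or> t = - ((- int P) ^ i)"
      by (simp add: power2_eq_iff)
    moreover have "t \<noteq> - ((- int P) ^ i)"
    proof
      assume "t = - ((- int P) ^ i)"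
      then have "[- ((- int P) ^ i) = 1] (mod int M)" using c2 by simp
      then have "[- ((- int P) ^ i) + (- int P) ^ i = 1 + 1] (mod int M)" using c1 by (rule cong_add)
      then have "int M dvd 2" by (simp add: cong_iff_dvd_diff)
      then have "int M \<le> 2" by (rule zdvd_imp_le) simp
      then show False using P_gt_1 by (simp add: M_eq)
    qed
    ultimately show ?thesis by blast
  qed
  show ?thesis
  proof (cases "\<exists>z. z \<noteq> 0 \<and> (a * z ^ M) ^ (P - 1) = - 1")
    case True
    then have "t\<^sup>2 = (int P ^ (g + 1))\<^sup>2"
      unfolding sq card_kernel[OF assms] by (simp add: power_add power2_eq_square mult_2 mult_2_right mult_ac)
    from sign[OF this] show ?thesis
      using True by (simp add: S_t power_minus[of "of_nat P :: complex"])
  next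
    case False
    then have "t\<^sup>2 = (int P ^ g)\<^sup>2"
      unfolding sq card_kernel[OF assms] if_not_P[OF False]
      by (simp add: power_add power2_eq_square mult_2)
    from sign[OF this] show ?thesis
      unfolding if_not_P[OF False] by (simp add: S_t power_minus[of "of_nat P :: complex"])
  qed
qed

text \<open>
  The sum \<open>hermitian_sum a\<close> takes its exceptional value on a single coset of the \<open>M\<close>-th powers, namely
  that of a solution of \<open>u ^ (P - 1) = - 1\<close>. The exponent \<open>k\<close> of such a solution is, modulo \<open>M\<close>,
  \<open>0\<close> if \<open>p = 2\<close> or \<open>g\<close> is even, and \<open>M div 2\<close> otherwise.
\<close>
lemma exceptional_exponent:
  obtains k where "(\<alpha> ^ k) ^ (P - 1) = - 1"
    and "\<And>d. d dvd M \<Longrightarrow> d dvd k \<longleftrightarrow> (odd p \<longrightarrow> even g \<or> d dvd M div 2)"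
proof (cases "odd p")
  case False
  then have "p = 2" using prime_p primes_dvd_imp_eq two_is_prime_nat by blast
  then have "(- 1 :: 'a) = 1" by (intro uminus_CHAR_2) (simp add: CHAR_eq)
  then show ?thesis using that[of 0] False by simp
next
  case True
  \<comment> \<open>\<open>G\<close> is the index \<open>w div (P\<^sup>2 - 1)\<close>, and \<open>\<alpha> ^ (w div 2) = - 1\<close>.\<close>
  define G where "G = (\<Sum>i<g. (P\<^sup>2) ^ i)"
  have oddP: "odd P" using True by (simp add: P_eq)
  then have "even M" by (simp add: M_eq)
  then obtain h where h: "M = 2 * h" by blast
  have h2: "M div 2 = h" using h by simp
  have w: "w = (P\<^sup>2 - 1) * G"
  proof -
    have "int w = int (P\<^sup>2) ^ g - 1"
      using P_gt_1 by (simp add: w_eq card_eq of_nat_diff)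
    also have "\<dots> = (int (P\<^sup>2) - 1) * (\<Sum>i<g. int (P\<^sup>2) ^ i)"
      by (rule power_diff_1_eq)
    also have "\<dots> = int ((P\<^sup>2 - 1) * G)"
      using P_gt_1 by (simp add: G_def of_nat_diff)
    finally show ?thesis by (simp only: of_nat_eq_iff)
  qed
  have w2: "w = 2 * (h * G * (P - 1))"
    unfolding w square_pred h by (simp only: mult_ac)
  have "\<not> w dvd h * G * (P - 1)"
  proof
    assume *: "w dvd h * G * (P - 1)"
    moreover have "h * G * (P - 1) > 0" using w2 w_pos by linarith
    ultimately have "w \<le> h * G * (P - 1)" by (rule dvd_imp_le)
    then show False using w2 w_pos by linarith
  qed
  then have "\<alpha> ^ (h * G * (P - 1)) \<noteq> 1" by (simp add: alpha_power_eq_1_iff)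
  moreover have "(\<alpha> ^ (h * G * (P - 1)))\<^sup>2 = 1"
    unfolding power_mult[symmetric] alpha_power_eq_1_iff w2 by (simp add: mult.commute)
  ultimately have "\<alpha> ^ (h * G * (P - 1)) = - 1"
    using power2_eq_1_iff by blast
  then have root: "(\<alpha> ^ (h * G)) ^ (P - 1) = - 1"
    by (simp only: power_mult)
  have parity: "even G \<longleftrightarrow> even g"
    unfolding G_def by (induction g) (use oddP in auto)
  have "d dvd h * G \<longleftrightarrow> even g \<or> d dvd h" if d: "d dvd M" for d
  proof (cases "even g")
    case True
    then obtain c where "G = 2 * c" using parity by blast
    then have "h * G = M * c" by (simp add: h)
    then show ?thesis using d True by simp
  next
    case False
    then obtain c where "G = 2 * c + 1" using parity by (auto elim: oddE)
    then have "h * G = M * c + h" by (simp add: h algebra_simps)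
    then show ?thesis using d False by (simp add: dvd_add_right_iff)
  qed
  then show ?thesis using that[of "h * G", OF root] True by (simp add: h2)
qed

text \<open>
  The quotient of two solutions of \<open>u ^ (P - 1) = - 1\<close> is a \<open>(P - 1)\<close>-th root of unity, and such
  a root is an \<open>M\<close>-th power because \<open>(P - 1) * M\<close> divides \<open>w\<close>.
\<close>
lemma exceptional_iff:
  assumes u: "u ^ (P - 1) = - 1" and "x \<noteq> 0"
  shows "(\<exists>z. z \<noteq> 0 \<and> (x * z ^ M) ^ (P - 1) = - 1) \<longleftrightarrow> inverse u * x \<in> nonzero_powers M"
proof
  have u0: "u \<noteq> 0" using u P_gt_1 by (auto simp: power_0_left)
  assume "\<exists>z. z \<noteq> 0 \<and> (x * z ^ M) ^ (P - 1) = - 1"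
  then obtain z where z: "z \<noteq> 0" "(x * z ^ M) ^ (P - 1) = - 1" by blast
  obtain c where c: "w = (P - 1) * (M * c)"
    using square_pred_dvd_w square_pred by (metis dvd_def mult.assoc)
  have "(inverse u * (x * z ^ M)) ^ (P - 1) = 1"
    unfolding power_mult_distrib[of "inverse u"] power_inverse u z by simp
  then have "inverse u * (x * z ^ M) \<in> nonzero_powers (w div (P - 1))"
    using roots_of_unity_eq_powers[of "P - 1"] c by auto
  moreover have "w div (P - 1) = M * c" using c P_gt_1 by simp
  ultimately have "inverse u * (x * z ^ M) \<in> nonzero_powers M"
    using nonzero_powers_mono[of M "M * c"] by auto
  moreover have "z ^ M \<in> nonzero_powers M" using z by (auto simp: nonzero_powers_def)
  ultimately show "inverse u * x \<in> nonzero_powers M"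
    using nonzero_powers_mult_iff[of "z ^ M" M "inverse u * x"] by (simp add: mult_ac)
next
  have u0: "u \<noteq> 0" using u P_gt_1 by (auto simp: power_0_left)
  assume "inverse u * x \<in> nonzero_powers M"
  then obtain y where y: "y \<noteq> 0" "inverse u * x = y ^ M" by (auto simp: nonzero_powers_def)
  then have "x = u * y ^ M" using u0 by (simp add: field_simps)
  then have "x * inverse y ^ M = u" using y by (simp add: field_simps)
  then show "\<exists>z. z \<noteq> 0 \<and> (x * z ^ M) ^ (P - 1) = - 1"
    using y u by (intro exI[of _ "inverse y"]) simp
qed

text \<open>
  The period of type \<open>d\<close> is \<open>1 / w\<close> times the sum of \<open>hermitian_sum x - 1\<close> over the \<open>d\<close>-th powers
  \<open>x\<close>, because multiplication by \<open>y ^ M\<close> permutes these.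
\<close>
lemma period_semiprimitive:
  assumes "d dvd M"
  shows "period d = ((-1) ^ g * of_nat P ^ g - 1) / of_nat d -
           (if odd p \<longrightarrow> even g \<or> d dvd M div 2 then (-1) ^ g * of_nat P ^ g else 0)"
proof -
  define A :: complex where "A = (-1) ^ g * of_nat P ^ g"
  obtain k where k: "(\<alpha> ^ k) ^ (P - 1) = - 1"
    and good: "d dvd k \<longleftrightarrow> (odd p \<longrightarrow> even g \<or> d dvd M div 2)"
    using exceptional_exponent assms by metis
  define u where "u = \<alpha> ^ k"
  define E where "E = {x \<in> nonzero_powers d. inverse u * x \<in> nonzero_powers M}"
  have u0: "u \<noteq> 0" by (simp add: u_def)
  have dw: "d dvd w" using assms M_dvd_w by (rule dvd_trans)
  have d: "d > 0" using dw w_pos by (auto intro: Nat.gr0I)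
  have M0: "M > 0" by (simp add: M_eq)
  have card_d: "of_nat (card (nonzero_powers d)) = (of_nat w / of_nat d :: complex)"
    using card_nonzero_powers[OF dw] d by (simp add: field_simps flip: of_nat_mult)
  have card_E: "of_nat M * of_nat (card E) = (if d dvd k then of_nat w else 0 :: complex)"
  proof (cases "d dvd k")
    case True
    then have ud: "u \<in> nonzero_powers d"
      using alpha_power_in_nonzero_powers[OF dw] by (simp add: u_def)
    have "bij_betw (\<lambda>x. u * x) (nonzero_powers M) E"
    proof (rule bij_betwI[of _ _ _ "\<lambda>x. inverse u * x"])
      show "(\<lambda>x. u * x) \<in> nonzero_powers M \<rightarrow> E"
        using nonzero_powers_mult[OF ud] nonzero_powers_mono[OF assms] u0
        by (auto simp: E_def simp flip: mult.assoc)
    qed (use u0 in \<open>auto simp: E_def simp flip: mult.assoc\<close>)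
    then have "card E = card (nonzero_powers M)" by (simp add: bij_betw_same_card)
    then have "M * card E = w" using card_nonzero_powers[OF M_dvd_w] by simp
    then show ?thesis using True by (simp flip: of_nat_mult)
  next
    case False
    then have ud: "u \<notin> nonzero_powers d"
      using alpha_power_in_nonzero_powers[OF dw] by (simp add: u_def)
    have "x \<notin> E" for x
    proof
      assume "x \<in> E"
      then have x: "x \<in> nonzero_powers d" "inverse u * x \<in> nonzero_powers d"
        using nonzero_powers_mono[OF assms] by (auto simp: E_def)
      have "inverse u \<in> nonzero_powers d"
        using nonzero_powers_mult_iff[OF x(1), of "inverse u"] x(2) by (simp add: mult.commute)
      then show False using ud nonzero_powers_inverse[of "inverse u" d] by simp
    qed
    then have "E = {}" by blast
    then show ?thesis using False by simp
  qed
  have S_val: "hermitian_sum x = A - (if x \<in> E then of_nat M * A else 0)" if "x \<in> nonzero_powers d" for x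
  proof -
    have "x \<noteq> 0" using that by (rule nonzero_powers_nonzero)
    show ?thesis
      unfolding hermitian_sum_value[OF \<open>x \<noteq> 0\<close>] exceptional_iff[OF k[folded u_def] \<open>x \<noteq> 0\<close>]
      using that by (simp add: E_def A_def M_eq algebra_simps)
  qed
  have "of_nat w * period d = (\<Sum>y\<in>- {0::'a}. period d)"
    by (simp add: card_nonzero)
  also have "\<dots> = (\<Sum>y\<in>- {0}. \<Sum>x\<in>nonzero_powers d. \<psi> (y ^ M * x))"
  proof (rule sum.cong[OF refl])
    fix y :: 'a assume "y \<in> - {0}"
    then have "y ^ M \<in> nonzero_powers d"
      using nonzero_powers_mono[OF assms] by (auto simp: nonzero_powers_def)
    then show "period d = (\<Sum>x\<in>nonzero_powers d. \<psi> (y ^ M * x))"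
      by (rule period_shift[symmetric])
  qed
  also have "\<dots> = (\<Sum>x\<in>nonzero_powers d. \<Sum>y\<in>- {0}. \<psi> (x * y ^ M))"
    by (subst sum.swap) (simp only: mult.commute)
  also have "\<dots> = (\<Sum>x\<in>nonzero_powers d. (A - 1) - (if x \<in> E then of_nat M * A else 0))"
  proof (rule sum.cong[OF refl])
    fix x assume "x \<in> nonzero_powers d"
    from S_val[OF this] show "(\<Sum>y\<in>- {0}. \<psi> (x * y ^ M)) =
      (A - 1) - (if x \<in> E then of_nat M * A else 0)"
      unfolding hermitian_sum_eq_nonzero by (simp add: algebra_simps split: if_splits)
  qed
  also have "\<dots> = of_nat (card (nonzero_powers d)) * (A - 1) - of_nat M * of_nat (card E) * A"
  proof -
    have "nonzero_powers d \<inter> E = E" by (auto simp: E_def)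
    then have "(\<Sum>x\<in>nonzero_powers d. if x \<in> E then of_nat M * A else 0) = of_nat (card E) * (of_nat M * A)"
      by (simp add: sum.If_cases)
    then show ?thesis by (simp add: sum_subtractf)
  qed
  also have "\<dots> = of_nat w * ((A - 1) / of_nat d - (if d dvd k then A else 0))"
    unfolding card_d card_E by (simp add: ring_distribs diff_divide_distrib)
  finally have "of_nat w * period d = of_nat w * ((A - 1) / of_nat d - (if d dvd k then A else 0))" .
  then have "period d = (A - 1) / of_nat d - (if d dvd k then A else 0)"
    using w_pos by (subst (asm) mult_cancel_left) simp
  then show ?thesis by (simp only: A_def good)
qed

end

end

section \<open>The value of the Moebius sum of the periods\<close>

lemma semiprimitive_exponentD:
  assumes "semiprimitive_exponent p n j"
  shows "j > 0" and "\<And>l. prime l \<Longrightarrow> l \<ge> 3 \<Longrightarrow> l dvd n \<Longrightarrow> [int p ^ j = - 1] (mod int l)"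
    and "\<And>i. i > 0 \<Longrightarrow> (\<And>l. prime l \<Longrightarrow> l \<ge> 3 \<Longrightarrow> l dvd n \<Longrightarrow> [int p ^ i = - 1] (mod int l)) \<Longrightarrow> j \<le> i"
  using assms unfolding semiprimitive_exponent_def is_arg_min_def id_def
  by (blast, blast, meson not_le)

text \<open>
  Let \<open>t\<close> be the residue of \<open>e\<close> modulo \<open>2 * j\<close>, so that \<open>p ^ t \<equiv> 1\<close>. If \<open>0 < t < j\<close> or
  \<open>j < t\<close>, then \<open>j - t\<close> or \<open>t - j\<close> would be a smaller exponent than \<open>j\<close>, and \<open>t = j\<close> would give
  \<open>1 \<equiv> - 1\<close> modulo an odd prime.
\<close>
lemma semiprimitive_exponent_dvd:
  assumes semi: "semiprimitive_exponent p n j"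
    and "n dvd p ^ e - 1" and "p > 0" and "\<exists>l. prime l \<and> l \<ge> 3 \<and> l dvd n"
  shows "2 * j dvd e"
proof -
  note j = semiprimitive_exponentD[OF semi]
  define t where "t = e mod (2 * j)"
  have t_less: "t < 2 * j" using j(1) by (simp add: t_def)
  have t_cong: "[int p ^ t = 1] (mod int l)" if l: "prime l" "l \<ge> 3" "l dvd n" for l
  proof -
    have "l dvd p ^ e - 1" using l(3) assms(2) by (rule dvd_trans)
    then have "int l dvd int (p ^ e - 1)" by (simp only: int_dvd_int_iff)
    then have e1: "[int p ^ e = 1] (mod int l)"
      using assms(3) by (simp add: cong_iff_dvd_diff of_nat_diff)
    have "[(int p ^ j) ^ 2 = (- 1) ^ 2] (mod int l)"
      by (intro cong_pow j(2) l)
    then have "[(int p ^ (2 * j)) ^ (e div (2 * j)) = 1 ^ (e div (2 * j))] (mod int l)"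
      by (intro cong_pow) (simp add: mult.commute flip: power_mult)
    then have "[(int p ^ (2 * j)) ^ (e div (2 * j)) * int p ^ t = 1 * int p ^ t] (mod int l)"
      by (intro cong_mult cong_refl) simp
    moreover have "(int p ^ (2 * j)) ^ (e div (2 * j)) * int p ^ t = int p ^ e"
      unfolding power_mult[symmetric] power_add[symmetric] t_def by simp
    ultimately show ?thesis using e1 by (simp add: cong_def)
  qed
  have "t = 0"
  proof (rule ccontr)
    assume "t \<noteq> 0"
    consider "t < j" | "t = j" | "t > j" by linarith
    then show False
    proof cases
      case 1
      have "[int p ^ (j - t) = - 1] (mod int l)" if l: "prime l" "l \<ge> 3" "l dvd n" for l
      proof -
        have "[int p ^ t * int p ^ (j - t) = 1 * int p ^ (j - t)] (mod int l)"
          by (intro cong_mult cong_refl t_cong l)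
        moreover have "int p ^ t * int p ^ (j - t) = int p ^ j"
          using 1 by (simp flip: power_add)
        ultimately show ?thesis using j(2)[OF l] by (simp add: cong_def)
      qed
      then have "j \<le> j - t" using 1 by (intro j(3)) auto
      then show False using \<open>t \<noteq> 0\<close> j(1) by simp
    next
      case 2
      obtain l where l: "prime l" "l \<ge> 3" "l dvd n" using assms(4) by blast
      have "[1 = - 1] (mod int l)"
        using t_cong[OF l] j(2)[OF l] unfolding 2 by (simp add: cong_def)
      then have "int l dvd 2" by (simp add: cong_iff_dvd_diff)
      then have "int l \<le> 2" by (rule zdvd_imp_le) simp
      then show False using l(2) by simp
    next
      case 3
      have "[int p ^ (t - j) = - 1] (mod int l)" if l: "prime l" "l \<ge> 3" "l dvd n" for l
      proof -
        have "[int p ^ j * int p ^ (t - j) = - 1 * int p ^ (t - j)] (mod int l)"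
          by (intro cong_mult cong_refl j(2) l)
        moreover have "int p ^ j * int p ^ (t - j) = int p ^ t"
          using 3 by (simp flip: power_add)
        ultimately have "[1 = - (int p ^ (t - j))] (mod int l)"
          using t_cong[OF l] by (simp add: cong_def)
        then have "[- 1 = - (- (int p ^ (t - j)))] (mod int l)"
          by (simp only: cong_minus_minus_iff)
        then show ?thesis by (simp add: cong_sym)
      qed
      then have "j \<le> t - j" using 3 by (intro j(3)) auto
      then show False using t_less by simp
    qed
  qed
  then show ?thesis by (simp add: t_def mod_eq_0_iff_dvd)
qed

theorem corollary1p8:
  fixes p s m q Q N n j \<gamma> K :: nat
    and \<alpha> :: "'a::{field, finite}"
    and \<epsilon> r \<eta> :: complex
  assumes "prime p" and "s > 0" and "q = p ^ s"
    and "m > 1" and "even (s * m)"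
    and "CARD('a) = q ^ m"
    and "primitive_element \<alpha>"
    and "Q = (q ^ m - 1) div (q - 1)"
    and "N dvd q ^ m - 1"
    and "n = gcd Q N" and "n > 1" and "\<nexists>k. n = 2 ^ k"
    and "semiprimitive_exponent p n j"
    \<comment> \<open>The other hypotheses imply that \<open>2 * j\<close> divides \<open>s * m\<close>, so this quotient is exact.\<close>
    and "\<gamma> = (s * m) div (2 * j)"
    and "K = coprime_part N Q"
    and "\<epsilon> = (if even n then 1 else 0)"
    and "r = of_real (real q powr (real m / 2))"
    \<comment> \<open>If \<open>p = 2\<close> then \<open>n\<close> is odd and \<open>\<eta>\<close> only occurs multiplied by \<open>\<epsilon> = 0\<close>.\<close>
    and "\<eta> = gaussian_period p (s * m) \<alpha> 2 0"
  shows "of_nat (Z_count q m N (0::'a)) =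
           (of_nat q - 1) * of_nat (totient K) / (of_nat q * of_nat K) *
           (of_nat Q / of_nat n * of_nat (totient n) + Delta p (s * m) \<alpha> 0 n)
       \<and> (if odd \<gamma> \<and> odd p \<and> even n \<and> odd ((p ^ j + 1) div 2)
          then Delta p (s * m) \<alpha> 0 n =
                 - \<eta> - (1 + r) * (1 / 2 + of_nat (totient n) / of_nat n)
          else Delta p (s * m) \<alpha> 0 n =
                 - \<epsilon> * (((-1) ^ \<gamma> * r + 1) / 2 + \<eta>)
                 + ((-1) ^ \<gamma> * r - 1) / of_nat n * of_nat (totient n))"
proof -
  note semi = \<open>semiprimitive_exponent p n j\<close>
  note j = semiprimitive_exponentD[OF semi]
  define e where "e = s * m"
  define w where w_qm: "w = q ^ m - 1"
  define P where "P = p ^ j"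
  define M where "M = P + 1"
  have p_gt_1: "p > 1" using assms(1) by (rule prime_gt_1_nat)
  have e_pos: "e > 0" using assms(2,4) by (simp add: e_def)
  have qm: "q ^ m = p ^ e" by (simp add: assms(3) e_def power_mult)
  interpret finite_field_char \<alpha> w p e
    by unfold_locales (use assms e_pos qm in \<open>simp_all add: w_qm\<close>)
  have Qw: "Q dvd w"
  proof -
    have "q - 1 dvd w" unfolding w_qm by (rule pred_dvd_pred_power)
    then show ?thesis by (auto simp: assms(8) w_qm)
  qed
  have nw: "n dvd p ^ e - 1"
    using Qw dvd_trans[of n Q w] by (simp add: assms(10) w_qm qm)
  have "2 * j dvd e"
    using semi nw p_gt_1 exists_odd_prime_divisor[of n] assms(11,12)
    by (intro semiprimitive_exponent_dvd) auto
  then have e_eq: "e = 2 * j * \<gamma>" by (simp add: assms(14) e_def)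
  have n_pos: "n > 0" using assms(11) by simp
  have odd_p: "odd p" if "even n"
  proof -
    have "even (p ^ e - 1)" using that nw by (rule dvd_trans)
    then show ?thesis using p_gt_1 e_pos by auto
  qed
  have even_M: "even M" if "odd p" using that by (simp add: M_def P_def)
  have prime_dvd_M: "l dvd M" if "prime l" "l dvd n" for l
  proof (cases "l = 2")
    case True
    then show ?thesis using that odd_p even_M by simp
  next
    case False
    then have "l \<ge> 3" using prime_gt_1_nat[OF that(1)] by linarith
    then have "int l dvd int p ^ j - (- 1)"
      using j(2)[of l] that unfolding cong_iff_dvd_diff by blast
    then have "int l dvd int M" by (simp add: M_def P_def add.commute)
    then show ?thesis by (simp only: int_dvd_int_iff)
  qed
  have dvd_M: "d dvd M" if "squarefree d" "d dvd n" for d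
  proof (rule squarefree_dvdI[OF that(1)])
    fix l assume "prime l" "l dvd d"
    then show "l dvd M" using prime_dvd_M dvd_trans[OF _ that(2)] by simp
  qed

  define A :: complex where "A = (-1) ^ \<gamma> * of_nat P ^ \<gamma>"
  \<comment> \<open>\<open>good d\<close> says that the exceptional coset consists of \<open>d\<close>-th powers.\<close>
  define good where "good d \<longleftrightarrow> (odd p \<longrightarrow> even \<gamma> \<or> d dvd M div 2)" for d
  have period: "period d = (A - 1) / of_nat d - (if good d then A else 0)"
    if "squarefree d" "d dvd n" for d
    unfolding good_def A_def
    by (rule period_semiprimitive[OF j(1) e_eq P_def M_def dvd_M[OF that]])
  \<comment> \<open>A squarefree divisor of \<open>M\<close> fails to divide \<open>M div 2\<close> only if it is even and \<open>M div 2\<close> is odd.\<close>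
  let ?exc = "odd \<gamma> \<and> odd p \<and> even n \<and> odd (M div 2)"
  have good_iff: "good d \<longleftrightarrow> \<not> (?exc \<and> even d)" if "squarefree d" "d dvd n" for d
  proof (cases "odd p \<and> odd \<gamma>")
    case True
    then have M2: "M = 2 * (M div 2)" using even_M by simp
    have "d dvd M div 2 \<longleftrightarrow> \<not> (?exc \<and> even d)"
    proof
      assume "d dvd M div 2"
      then show "\<not> (?exc \<and> even d)" using dvd_trans by blast
    next
      assume *: "\<not> (?exc \<and> even d)"
      show "d dvd M div 2"
      proof (rule squarefree_dvdI[OF that(1)])
        fix l assume l: "prime l" "l dvd d"
        then have ln: "l dvd n" using that(2) dvd_trans by blast
        show "l dvd M div 2"
        proof (cases "l = 2")
          case l2: True
          then show ?thesis using * l ln True by auto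
        next
          case False
          have "l dvd 2 * (M div 2)" using prime_dvd_M[OF l(1) ln] M2 by simp
          moreover have "\<not> l dvd 2" using False l(1) primes_dvd_imp_eq two_is_prime_nat by blast
          ultimately show ?thesis using l(1) prime_dvd_mult_iff by blast
        qed
      qed
    qed
    then show ?thesis using True by (simp add: good_def)
  qed (auto simp: good_def)
  have sum_good: "(\<Sum>d | d dvd n \<and> \<not> (?exc \<and> even d). moebius_mu d) = 0"
  proof (cases ?exc)
    case True
    then show ?thesis using sum_moebius_odd[OF n_pos assms(12)] by simp
  next
    case False
    then have "{d. d dvd n \<and> \<not> (?exc \<and> even d)} = {d. d dvd n}" by blast
    then show ?thesis using sum_moebius[OF n_pos] assms(11) by simp
  qed
  \<comment> \<open>The summands \<open>- A\<close> of the good divisors cancel, so both cases share this value.\<close>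
  have Delta: "Delta p e \<alpha> 0 n = (A - 1) * (of_nat (totient n) / of_nat n)"
  proof -
    have "Delta p e \<alpha> 0 n = (\<Sum>d | d dvd n. of_int (moebius_mu d) * period d)"
      by (simp add: Delta_def gaussian_period_0)
    also have "\<dots> = (\<Sum>d | d dvd n. (A - 1) * (of_int (moebius_mu d) / of_nat d) -
                        A * (if \<not> (?exc \<and> even d) then of_int (moebius_mu d) else 0))"
    proof (rule sum.cong[OF refl])
      fix d assume d: "d \<in> {d. d dvd n}"
      show "of_int (moebius_mu d) * period d =
            (A - 1) * (of_int (moebius_mu d) / of_nat d) -
              A * (if \<not> (?exc \<and> even d) then of_int (moebius_mu d) else 0)"
      proof (cases "squarefree d")
        case True
        show ?thesis
          unfolding period[OF True d[simplified]] good_iff[OF True d[simplified]]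
          by (simp add: algebra_simps)
      qed (simp add: moebius_mu_def)
    qed
    also have "\<dots> = (A - 1) * (of_nat (totient n) / of_nat n) -
        A * (\<Sum>d | d dvd n. if \<not> (?exc \<and> even d) then of_int (moebius_mu d) else 0)"
      unfolding sum_subtractf sum_distrib_left[symmetric] sum_moebius_div[OF n_pos] ..
    also have "(\<Sum>d | d dvd n. if \<not> (?exc \<and> even d) then of_int (moebius_mu d) else 0) =
               (of_int (\<Sum>d | d dvd n \<and> \<not> (?exc \<and> even d). moebius_mu d) :: complex)"
      using n_pos unfolding of_int_sum by (intro sum.mono_neutral_cong_right) auto
    finally show ?thesis unfolding sum_good by simp
  qed
  have r: "r = of_nat P ^ \<gamma>"
  proof -
    have "real q powr (real m / 2) = (real q powr real m) powr (1 / 2)"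
      by (simp add: powr_powr)
    also have "real q powr real m = real (q ^ m)"
      using p_gt_1 by (simp add: powr_realpow assms(3))
    also have "\<dots> = (real P ^ \<gamma>)\<^sup>2"
      unfolding qm e_eq by (simp add: P_def mult_ac flip: power_mult)
    also have "\<dots> powr (1 / 2) = real P ^ \<gamma>"
      by (simp add: powr_half_sqrt)
    finally show ?thesis by (simp add: assms(17))
  qed
  have A_r: "A = (-1) ^ \<gamma> * r" by (simp add: A_def r)
  have eta: "\<eta> = (A - 1) / 2 - (if ?exc then 0 else A)" if "even n"
  proof -
    have "squarefree (2::nat)" by (rule squarefree_prime) simp
    note two = this that
    have "\<eta> = period 2" unfolding assms(18) e_def[symmetric] by (rule gaussian_period_0)
    then show ?thesis
      unfolding period[OF two] good_iff[OF two] using that by simp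
  qed
  have M_eq: "p ^ j + 1 = M" by (simp add: M_def P_def)
  have Z: "of_nat (Z_count q m N (0::'a)) =
           (of_nat q - 1) * of_nat (totient K) / (of_nat q * of_nat K) *
           (of_nat Q / of_nat n * of_nat (totient n) + Delta p (s * m) \<alpha> 0 n)"
    using Z_count_zero[OF e_def assms(3) assms(8)[folded w_qm] assms(9)[folded w_qm] assms(10,15)]
    by (simp only: e_def)
  show ?thesis
  proof (cases ?exc)
    case True
    then have "A = - r" by (simp add: A_r)
    then have "Delta p e \<alpha> 0 n = - \<eta> - (1 + r) * (1 / 2 + of_nat (totient n) / of_nat n)"
    proof -
      have eta_r: "\<eta> = - (1 + r) / 2" using True eta \<open>A = - r\<close> by simp
      have ring: "(- r - 1) * t = - (- (1 + r) / 2) - (1 + r) * (1 / 2 + t)" for t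
        by (simp add: field_simps)
      show ?thesis unfolding Delta \<open>A = - r\<close> eta_r by (rule ring)
    qed
    then show ?thesis using Z True unfolding M_eq e_def by simp
  next
    case False
    have "\<epsilon> * ((A + 1) / 2 + \<eta>) = 0"
    proof (cases "even n")
      case True
      then have "\<eta> = (A - 1) / 2 - A" using eta unfolding if_not_P[OF False] by blast
      then show ?thesis by (simp add: field_simps)
    qed (simp add: assms(16))
    then have "Delta p e \<alpha> 0 n = - \<epsilon> * (((-1) ^ \<gamma> * r + 1) / 2 + \<eta>)
                 + ((-1) ^ \<gamma> * r - 1) / of_nat n * of_nat (totient n)"
      unfolding Delta A_r[symmetric] by simp
    then show ?thesis using Z unfolding M_eq e_def if_not_P[OF False] by simp
  qed
qed

end
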